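(* Let $\mathbf{Q}^{(1)},\dots,\mathbf{Q}^{(n)}\in\mathbb{K}^{m\times m}$ be symmetric matrices, let $\mathcal{S}_{\mathbb K}=\{\mathbf{x}\in\mathbb{K}_{\ge 0}^n : \mathbf{x}_1\mathbf{Q}^{(1)}+\dots+\mathbf{x}_n\mathbf{Q}^{(n)}\succeq 0\}$ be the associated spectrahedron, and let $Q^{(k)}=\mathrm{sval}(\mathbf{Q}^{(k)})\in\mathbb{T}_\pm^{m\times m}$ for $k\in[n]$. Suppose that: (i) for every $k\in[n]$ and every pair $i\ne j$ in $[m]$ such that $Q^{(k)}_{ii}$ and $Q^{(k)}_{jj}$ both belong to $\mathbb{T}_+$, we have $Q^{(k)}_{ii}+Q^{(k)}_{jj}\neq 2|Q^{(k)}_{ij}|$; (ii) for every subset $\Sigma\subset\{(i,j)\in[m]^2: i<j\}$ and every $\Diamond\in\{\le,\ge\}^{\Sigma^\complement}$, every stratum of the set $\mathcal{S}_{\Sigma,\Diamond}(Q^{(1)},\dots,Q^{(n)})$ is regular. Then $\mathrm{val}(\mathcal{S}_{\mathbb K})=\mathcal{S}(Q^{(1)},\dots,Q^{(n)})$.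
   Context: $[k]=\{1,\dots,k\}$. $\mathbb{K}$ is the field of formal generalized real Puiseux series: series $\mathbf{x}=\sum_{i\ge 1}c_{\lambda_i}t^{\lambda_i}$ where $(\lambda_i)$ is a strictly decreasing sequence of real numbers that is either finite or unbounded and $c_{\lambda_i}\in\mathbb{R}\setminus\{0\}$, together with the empty series $0$, with the natural addition and multiplication. The leading coefficient is $\mathrm{lc}(\mathbf{x})=c_{\lambda_1}$, $\mathrm{lc}(0)=0$; $\mathbb{K}$ is ordered by $\mathbf{x}\ge\mathbf{y}$ iff $\mathrm{lc}(\mathbf{x}-\mathbf{y})\ge 0$, and is a real closed field. $\mathbb{K}_{\ge0}$ is the set of nonnegative elements. $\succeq 0$ means positive semidefinite over $\mathbb{K}$. The valuation is $\mathrm{val}(\mathbf{x})=\lambda_1$, $\mathrm{val}(0)=-\infty$. $\mathbb{T}=\mathbb{R}\cup\{-\infty\}$ with its usual order and addition ($-\infty$ absorbing). $\mathbb{T}_\pm$ is the set of signed tropical numbers: pairs $(1,a)$ (written $a$; the set of these is $\mathbb{T}_+$), pairs $(-1,a)$ (written $\ominus a$; the set of these is $\mathbb{T}_-$), with $a\in\mathbb{R}$, and $-\infty$ (sign $0$). Modulus: $|a|=|\ominus a|=a$ and $|-\infty|=-\infty$. The signed valuation is $\mathrm{sval}(\mathbf{x})=(\mathrm{sign}(\mathbf{x}),\mathrm{val}(\mathbf{x}))\in\mathbb{T}_\pm$. $\mathrm{val}$ and $\mathrm{sval}$ are applied entrywise. For symmetric $Q^{(1)},\dots,Q^{(n)}\in\mathbb{T}_\pm^{m\times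 m}$, $i,j\in[m]$ and $x\in\mathbb{T}^n$, put $Q^+_{ij}(x)=\max\{|Q^{(k)}_{ij}|+x_k : k\in[n],\,Q^{(k)}_{ij}\in\mathbb{T}_+\}$ and $Q^-_{ij}(x)=\max\{|Q^{(k)}_{ij}|+x_k : k\in[n],\,Q^{(k)}_{ij}\in\mathbb{T}_-\}$, with $\max\emptyset=-\infty$. $\mathcal{S}(Q^{(1)},\dots,Q^{(n)})$ is the set of $x\in\mathbb{T}^n$ such that: for all $i\in[m]$, $Q^+_{ii}(x)\ge Q^-_{ii}(x)$; and for all $i<j$ in $[m]$, $Q^+_{ii}(x)+Q^+_{jj}(x)\ge 2\max(Q^+_{ij}(x),Q^-_{ij}(x))$ or $Q^+_{ij}(x)=Q^-_{ij}(x)$. For $\Sigma\subset\{(i,j)\in[m]^2:i<j\}$, $\Sigma^\complement=\{(i,j)\in[m]^2:i<j,(i,j)\notin\Sigma\}$. For $\Diamond\in\{\le,\ge\}^{\Sigma^\complement}$, $\mathcal{S}_{\Sigma,\Diamond}(Q^{(1)},\dots,Q^{(n)})$ is the set of $x\in\mathbb{T}^n$ such that: for all $i\in[m]$, $Q^+_{ii}(x)\ge Q^-_{ii}(x)$; for all $(i,j)\in\Sigma$, $Q^+_{ii}(x)+Q^+_{jj}(x)\ge 2\max(Q^+_{ij}(x),Q^-_{ij}(x))$; for all $(i,j)\in\Sigma^\complement$, $Q^+_{ij}(x)\mathrel{\Diamond_{(i,j)}}Q^-_{ij}(x)$. The support of $x\in\mathbb{T}^n$ is $\{k: x_k\ne-\infty\}$.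 For nonempty $K\subset[n]$, the stratum of $S\subset\mathbb{T}^n$ associated with $K$ is the set of $(x_k)_{k\in K}\in\mathbb{R}^K$ for $x\in S$ with support exactly $K$. A set $S\subset\mathbb{R}^p$ is regular if it is closed and $S=\mathrm{cl}(\mathrm{int}(S))$ (Euclidean topology). *)

theory Defs
  imports "HOL-Analysis.Analysis"
begin

section \<open>Generalized real Puiseux series\<close>

text \<open>
  A series is represented by its coefficient function. Its support is finite or the range of a
  strictly decreasing sequence of exponents that is unbounded below.
\<close>

definition puiseux_supp :: "real set \<Rightarrow> bool" where
  "puiseux_supp S \<longleftrightarrow>
     finite S \<or>
     (\<exists>l :: nat \<Rightarrow> real. (\<forall>i j. i < j \<longrightarrow> l j < l i) \<and> \<not> bdd_below (range l) \<and> S = range l)"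

lemma puiseux_supp_iff: "puiseux_supp S \<longleftrightarrow> (\<forall>a. finite {l \<in> S. a \<le> l})"
proof
  assume "puiseux_supp S"
  then consider "finite S"
    | l :: "nat \<Rightarrow> real" where "\<forall>i j. i < j \<longrightarrow> l j < l i" "\<not> bdd_below (range l)" "S = range l"
    unfolding puiseux_supp_def by (elim disjE exE conjE) auto
  then show "\<forall>a. finite {l \<in> S. a \<le> l}"
  proof cases
    case 1
    then show ?thesis by simp
  next
    case 2
    show ?thesis
    proof
      fix a
      obtain N where N: "l N < a"
        using 2(2) by (force simp: bdd_below_def not_le)
      have "{s \<in> S. a \<le> s} \<subseteq> l ` {..<N}"
      proof
        fix s assume "s \<in> {s \<in> S. a \<le> s}"
        then obtain i where i: "s = l i" "a \<le> l i" using 2(3) by auto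
        have "i < N"
        proof (rule ccontr)
          assume "\<not> i < N"
          then have "i = N \<or> N < i" by linarith
          then have "l i \<le> l N" using 2(1) by (auto intro: less_imp_le)
          with N i show False by simp
        qed
        with i show "s \<in> l ` {..<N}" by auto
      qed
      then show "finite {s \<in> S. a \<le> s}" by (rule finite_subset) simp
    qed
  qed
next
  assume fin: "\<forall>a. finite {l \<in> S. a \<le> l}"
  show "puiseux_supp S"
  proof (cases "finite S")
    case True
    then show ?thesis by (simp add: puiseux_supp_def)
  next
    case inf: False
    define P where "P b m \<longleftrightarrow> m \<in> S \<and> m < b \<and> (\<forall>s\<in>S. s < b \<longrightarrow> s \<le> m)" for b m
    have ex: "\<exists>m. P b m" for b
    proof -
      have "\<exists>s\<in>S. s < b"
      proof (rule ccontr)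
        assume "\<not> (\<exists>s\<in>S. s < b)"
        then have "S = {s \<in> S. b \<le> s}" by auto
        with inf fin show False by metis
      qed
      then obtain s where s: "s \<in> S" "s < b" by auto
      let ?F = "{u \<in> S. s \<le> u} \<inter> {u. u < b}"
      have F: "finite ?F" "s \<in> ?F" using fin s by auto
      then have "Max ?F \<in> ?F" by (metis Max_in empty_iff)
      moreover have "u \<le> Max ?F" if "u \<in> S" "u < b" for u
      proof (cases "s \<le> u")
        case True
        then show ?thesis using F that by simp
      next
        case False
        moreover have "s \<le> Max ?F" using F by (intro Max_ge)
        ultimately show ?thesis by linarith
      qed
      ultimately show ?thesis unfolding P_def by blast
    qed
    obtain s0 where s0: "\<forall>s\<in>S. s < s0"
    proof -
      have fS: "finite {s \<in> S. 0 \<le> s}" using fin by simp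
      have "s < Max (insert 0 {s \<in> S. 0 \<le> s}) + 1" if "s \<in> S" for s
      proof -
        have "s \<le> Max (insert 0 {s \<in> S. 0 \<le> s})"
        proof (cases "0 \<le> s")
          case True
          then show ?thesis using fS that by (intro Max_ge) auto
        next
          case False
          moreover have "0 \<le> Max (insert 0 {s \<in> S. 0 \<le> s})" using fS by (intro Max_ge) auto
          ultimately show ?thesis by linarith
        qed
        then show ?thesis by simp
      qed
      then show ?thesis using that by blast
    qed
    define nxt where "nxt b = (SOME m. P b m)" for b
    have nxt: "P b (nxt b)" for b unfolding nxt_def using ex by (rule someI_ex)
    define l where "l n = rec_nat (nxt s0) (\<lambda>_ b. nxt b) n" for n
    have l0: "l 0 = nxt s0" and lS: "l (Suc n) = nxt (l n)" for n by (simp_all add: l_def)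
    have "l (Suc n) < l n" for n using nxt[of "l n"] lS by (simp add: P_def)
    then have dec: "l j < l i" if "i < j" for i j
      using that by (metis lift_Suc_mono_less[of "\<lambda>n. - l n"] neg_less_iff_less)
    have inS: "l n \<in> S" for n
      using nxt[of s0] nxt[of "l (n - 1)"] l0 lS by (cases n) (auto simp: P_def)
    have injl: "inj l" by (metis dec injI less_irrefl linorder_less_linear)
    have nb: "\<not> (\<forall>n. b \<le> l n)" for b
    proof
      assume "\<forall>n. b \<le> l n"
      then have "range l \<subseteq> {s \<in> S. b \<le> s}" using inS by auto
      then have "finite (range l)" using fin finite_subset by blast
      then show False using injl finite_imageD by blast
    qed
    have "S \<subseteq> range l"
    proof (rule subsetI, rule ccontr)
      fix s assume s: "s \<in> S" "s \<notin> range l"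
      have "s \<le> l n" for n
      proof (induction n)
        case 0
        then show ?case using nxt[of s0] s s0 l0 by (auto simp: P_def)
      next
        case (Suc n)
        then have "s < l n" using s by (metis order_le_less rangeI)
        then show ?case using nxt[of "l n"] s lS by (auto simp: P_def)
      qed
      with nb show False by blast
    qed
    with inS have "S = range l" by auto
    moreover have "\<not> bdd_below (range l)" using nb by (auto simp: bdd_below_def)
    ultimately show ?thesis unfolding puiseux_supp_def using dec
      by (intro disjI2 exI[of _ l]) auto
  qed
qed

typedef puiseux = "{f :: real \<Rightarrow> real. puiseux_supp {l. f l \<noteq> 0}}"
  morphisms pcoeff Abs_puiseux
  by (rule exI[of _ "\<lambda>_. 0"]) (simp add: puiseux_supp_def)

setup_lifting type_definition_puiseux

lemma puiseux_eqI: "(\<And>l. pcoeff x l = pcoeff y l) \<Longrightarrow> x = y"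
  by (meson pcoeff_inject ext)

lemma pcoeff_finite: "finite {l. pcoeff x l \<noteq> 0 \<and> a \<le> l}"
  using pcoeff[of x] by (simp add: puiseux_supp_iff)

lemma puiseux_supp_mono: "puiseux_supp T \<Longrightarrow> S \<subseteq> T \<Longrightarrow> puiseux_supp S"
  unfolding puiseux_supp_iff by (auto elim!: rev_finite_subset)

lemma puiseux_supp_Un: "puiseux_supp S \<Longrightarrow> puiseux_supp T \<Longrightarrow> puiseux_supp (S \<union> T)"
  unfolding puiseux_supp_iff
proof
  fix a assume "\<forall>a. finite {l \<in> S. a \<le> l}" "\<forall>a. finite {l \<in> T. a \<le> l}"
  moreover have "{l \<in> S \<union> T. a \<le> l} = {l \<in> S. a \<le> l} \<union> {l \<in> T. a \<le> l}" by auto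
  ultimately show "finite {l \<in> S \<union> T. a \<le> l}" by simp
qed

lemma puiseux_supp_bdd: "puiseux_supp S \<Longrightarrow> \<exists>B. \<forall>l\<in>S. l \<le> B"
proof -
  assume S: "puiseux_supp S"
  have "bdd_above {l \<in> S. 0 \<le> l}" using S unfolding puiseux_supp_iff
    by (intro bdd_above_finite) auto
  then obtain M where "\<forall>l\<in>S. 0 \<le> l \<longrightarrow> l \<le> M" unfolding bdd_above_def by auto
  then have "\<forall>l\<in>S. l \<le> max 0 M" by fastforce
  then show ?thesis by blast
qed

lemma puiseux_supp_coeff: "puiseux_supp {l. pcoeff x l \<noteq> 0}"
  using pcoeff[of x] by simp

lemma pcoeff_bdd: obtains B where "\<And>l. pcoeff x l \<noteq> 0 \<Longrightarrow> l \<le> B"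
  using puiseux_supp_bdd[OF puiseux_supp_coeff[of x]] by auto

lemma mult_support_finite: "finite {p. pcoeff x p \<noteq> 0 \<and> pcoeff y (l - p) \<noteq> 0}"
proof -
  obtain B where B: "\<And>l. pcoeff y l \<noteq> 0 \<Longrightarrow> l \<le> B" using pcoeff_bdd[of y] by blast
  have "{p. pcoeff x p \<noteq> 0 \<and> pcoeff y (l - p) \<noteq> 0} \<subseteq> {p. pcoeff x p \<noteq> 0 \<and> l - B \<le> p}"
    using B by force
  then show ?thesis using pcoeff_finite finite_subset by blast
qed

lemma puiseux_supp_mult:
  "puiseux_supp {l. \<exists>p q. pcoeff x p \<noteq> 0 \<and> pcoeff y q \<noteq> 0 \<and> l = p + q}"
  unfolding puiseux_supp_iff
proof
  fix a
  obtain B where B: "\<And>l. pcoeff x l \<noteq> 0 \<Longrightarrow> l \<le> B" using pcoeff_bdd[of x] by blast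
  obtain C where C: "\<And>l. pcoeff y l \<noteq> 0 \<Longrightarrow> l \<le> C" using pcoeff_bdd[of y] by blast
  let ?F = "(\<lambda>(p, q). p + q) `
      ({l. pcoeff x l \<noteq> 0 \<and> a - C \<le> l} \<times> {l. pcoeff y l \<noteq> 0 \<and> a - B \<le> l})"
  have "{l \<in> {l. \<exists>p q. pcoeff x p \<noteq> 0 \<and> pcoeff y q \<noteq> 0 \<and> l = p + q}. a \<le> l} \<subseteq> ?F"
  proof
    fix l assume "l \<in> {l \<in> {l. \<exists>p q. pcoeff x p \<noteq> 0 \<and> pcoeff y q \<noteq> 0 \<and> l = p + q}. a \<le> l}"
    then obtain p q where pq: "pcoeff x p \<noteq> 0" "pcoeff y q \<noteq> 0" "l = p + q" "a \<le> l" by auto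
    then have "a - C \<le> p" "a - B \<le> q" using B[of p] C[of q] by auto
    with pq show "l \<in> ?F" by force
  qed
  moreover have "finite ?F" by (intro finite_imageI finite_cartesian_product pcoeff_finite)
  ultimately show "finite {l \<in> {l. \<exists>p q. pcoeff x p \<noteq> 0 \<and> pcoeff y q \<noteq> 0 \<and> l = p + q}. a \<le> l}"
    by (rule finite_subset)
qed

instantiation puiseux :: "{zero, one, plus, uminus, minus, times}"
begin

lift_definition zero_puiseux :: puiseux is "\<lambda>_. 0" by (simp add: puiseux_supp_def)

lift_definition one_puiseux :: puiseux is "\<lambda>l. if l = 0 then 1 else 0"
  by (simp add: puiseux_supp_def)

lift_definition plus_puiseux :: "puiseux \<Rightarrow> puiseux \<Rightarrow> puiseux" is "\<lambda>f g l. f l + g l"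
  by (erule (1) puiseux_supp_mono[OF puiseux_supp_Un]) auto

lift_definition uminus_puiseux :: "puiseux \<Rightarrow> puiseux" is "\<lambda>f l. - f l" by simp

lift_definition minus_puiseux :: "puiseux \<Rightarrow> puiseux \<Rightarrow> puiseux" is "\<lambda>f g l. f l - g l"
  by (erule (1) puiseux_supp_mono[OF puiseux_supp_Un]) auto

(* The index set of the sum is finite, see mult_support_finite. *)
definition times_puiseux :: "puiseux \<Rightarrow> puiseux \<Rightarrow> puiseux" where
  "x * y = Abs_puiseux
     (\<lambda>l. \<Sum>p \<in> {p. pcoeff x p \<noteq> 0 \<and> pcoeff y (l - p) \<noteq> 0}. pcoeff x p * pcoeff y (l - p))"

instance ..

end

lemma pcoeff_zero [simp]: "pcoeff 0 l = 0"
  and pcoeff_one: "pcoeff 1 l = (if l = 0 then 1 else 0)"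
  and pcoeff_plus [simp]: "pcoeff (x + y) l = pcoeff x l + pcoeff y l"
  and pcoeff_uminus [simp]: "pcoeff (- x) l = - pcoeff x l"
  and pcoeff_minus [simp]: "pcoeff (x - y) l = pcoeff x l - pcoeff y l"
  by (transfer, simp)+

lemma pcoeff_times:
  "pcoeff (x * y) l = (\<Sum>p \<in> {p. pcoeff x p \<noteq> 0 \<and> pcoeff y (l - p) \<noteq> 0}. pcoeff x p * pcoeff y (l - p))"
proof -
  let ?f = "\<lambda>l. \<Sum>p \<in> {p. pcoeff x p \<noteq> 0 \<and> pcoeff y (l - p) \<noteq> 0}. pcoeff x p * pcoeff y (l - p)"
  have "{l. ?f l \<noteq> 0} \<subseteq> {l. \<exists>p q. pcoeff x p \<noteq> 0 \<and> pcoeff y q \<noteq> 0 \<and> l = p + q}"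
  proof
    fix l assume "l \<in> {l. ?f l \<noteq> 0}"
    then have "?f l \<noteq> 0" by simp
    then obtain p where "p \<in> {p. pcoeff x p \<noteq> 0 \<and> pcoeff y (l - p) \<noteq> 0}"
      by (meson sum.not_neutral_contains_not_neutral)
    then show "l \<in> {l. \<exists>p q. pcoeff x p \<noteq> 0 \<and> pcoeff y q \<noteq> 0 \<and> l = p + q}"
      by (intro CollectI exI[of _ p] exI[of _ "l - p"]) auto
  qed
  then have "puiseux_supp {l. ?f l \<noteq> 0}" by (rule puiseux_supp_mono[OF puiseux_supp_mult])
  then show ?thesis unfolding times_puiseux_def by (subst Abs_puiseux_inverse) auto
qed

lemma pcoeff_times_superset:
  assumes "finite A" "\<And>p. pcoeff x p \<noteq> 0 \<Longrightarrow> pcoeff y (l - p) \<noteq> 0 \<Longrightarrow> p \<in> A"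
  shows "pcoeff (x * y) l = (\<Sum>p\<in>A. pcoeff x p * pcoeff y (l - p))"
  unfolding pcoeff_times using assms by (intro sum.mono_neutral_left) auto

lemma pcoeff_times_nonzeroD:
  assumes "pcoeff (x * y) l \<noteq> 0"
  obtains p q where "pcoeff x p \<noteq> 0" "pcoeff y q \<noteq> 0" "l = p + q"
proof -
  obtain p where "p \<in> {p. pcoeff x p \<noteq> 0 \<and> pcoeff y (l - p) \<noteq> 0}"
    using assms unfolding pcoeff_times by (meson sum.not_neutral_contains_not_neutral)
  then show ?thesis using that[of p "l - p"] by auto
qed

lemma pcoeff_times_double:
  assumes "finite A" "finite B"
    and "\<And>p q. pcoeff x p \<noteq> 0 \<Longrightarrow> pcoeff y q \<noteq> 0 \<Longrightarrow> p + q = l \<Longrightarrow> p \<in> A \<and> q \<in> B"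
  shows "pcoeff (x * y) l = (\<Sum>p\<in>A. \<Sum>q\<in>B. if p + q = l then pcoeff x p * pcoeff y q else 0)"
proof -
  have "(\<Sum>q\<in>B. if p + q = l then pcoeff x p * pcoeff y q else 0) = pcoeff x p * pcoeff y (l - p)"
    if "p \<in> A" for p
  proof -
    have "(\<Sum>q\<in>B. if p + q = l then pcoeff x p * pcoeff y q else 0)
        = (\<Sum>q\<in>B. if q = l - p then pcoeff x p * pcoeff y (l - p) else 0)"
      by (rule sum.cong) (auto simp: algebra_simps)
    also have "\<dots> = (if l - p \<in> B then pcoeff x p * pcoeff y (l - p) else 0)"
      using assms(2) by (simp add: sum.delta)
    also have "\<dots> = pcoeff x p * pcoeff y (l - p)" using assms(3)[of p "l - p"] by auto
    finally show ?thesis .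
  qed
  moreover have "pcoeff (x * y) l = (\<Sum>p\<in>A. pcoeff x p * pcoeff y (l - p))"
  proof (rule pcoeff_times_superset)
    show "p \<in> A" if "pcoeff x p \<noteq> 0" "pcoeff y (l - p) \<noteq> 0" for p
      using assms(3)[of p "l - p"] that by auto
  qed (rule assms)
  ultimately show ?thesis by simp
qed

definition trunc_supp :: "puiseux \<Rightarrow> real \<Rightarrow> real set" where
  "trunc_supp x a = {p. pcoeff x p \<noteq> 0 \<and> a \<le> p}"

lemma puiseux_mult_commute: "x * y = y * (x :: puiseux)"
proof (rule puiseux_eqI)
  fix l
  let ?A = "{p. pcoeff x p \<noteq> 0 \<and> pcoeff y (l - p) \<noteq> 0}"
  let ?B = "{p. pcoeff y p \<noteq> 0 \<and> pcoeff x (l - p) \<noteq> 0}"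
  have fin: "finite ?A" "finite ?B" by (rule mult_support_finite)+
  have mem: "p \<in> ?A \<and> q \<in> ?B" if "pcoeff x p \<noteq> 0" "pcoeff y q \<noteq> 0" "p + q = l" for p q
    using that by (auto simp: algebra_simps)
  have "pcoeff (x * y) l = (\<Sum>p\<in>?A. \<Sum>q\<in>?B. if p + q = l then pcoeff x p * pcoeff y q else 0)"
    using fin mem by (rule pcoeff_times_double)
  also have "\<dots> = (\<Sum>q\<in>?B. \<Sum>p\<in>?A. if p + q = l then pcoeff x p * pcoeff y q else 0)"
    by (rule sum.swap)
  also have "\<dots> = (\<Sum>q\<in>?B. \<Sum>p\<in>?A. if q + p = l then pcoeff y q * pcoeff x p else 0)"
    by (intro sum.cong refl) (simp add: ac_simps)
  also have "\<dots> = pcoeff (y * x) l"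
    by (rule pcoeff_times_double[symmetric]) (use fin mem in \<open>auto simp: algebra_simps\<close>)
  finally show "pcoeff (x * y) l = pcoeff (y * x) l" .
qed

lemma pcoeff_times_triple:
  fixes l M :: real
  assumes x: "\<And>l. pcoeff x l \<noteq> 0 \<Longrightarrow> l \<le> M" and y: "\<And>l. pcoeff y l \<noteq> 0 \<Longrightarrow> l \<le> M"
    and z: "\<And>l. pcoeff z l \<noteq> 0 \<Longrightarrow> l \<le> M" and "0 \<le> M"
  defines "a \<equiv> l - 2 * M"
  shows "pcoeff (x * y * z) l = (\<Sum>p\<in>trunc_supp x a. \<Sum>q\<in>trunc_supp y a. \<Sum>r\<in>trunc_supp z a.
      if p + q + r = l then pcoeff x p * pcoeff y q * pcoeff z r else 0)"
proof -
  let ?A = "trunc_supp x a" and ?B = "trunc_supp y a" and ?C = "trunc_supp z a"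
  have fin: "finite ?A" "finite ?B" "finite ?C" unfolding trunc_supp_def by (rule pcoeff_finite)+
  define S where "S = {s \<in> (\<lambda>(p, q). p + q) ` (?A \<times> ?B). l - M \<le> s}"
  have finS: "finite S" unfolding S_def using fin by simp
  have xy: "pcoeff (x * y) s = (\<Sum>p\<in>?A. \<Sum>q\<in>?B. if p + q = s then pcoeff x p * pcoeff y q else 0)"
    if "l - M \<le> s" for s
  proof (rule pcoeff_times_double)
    fix p q assume "pcoeff x p \<noteq> 0" "pcoeff y q \<noteq> 0" "p + q = s"
    then show "p \<in> ?A \<and> q \<in> ?B"
      using x[of p] y[of q] that unfolding trunc_supp_def a_def by auto
  qed (use fin in auto)
  have "pcoeff (x * y * z) l = (\<Sum>s\<in>S. \<Sum>r\<in>?C. if s + r = l then pcoeff (x * y) s * pcoeff z r else 0)"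
  proof (rule pcoeff_times_double)
    fix s r assume sr: "pcoeff (x * y) s \<noteq> 0" "pcoeff z r \<noteq> 0" "s + r = l"
    obtain p q where pq: "pcoeff x p \<noteq> 0" "pcoeff y q \<noteq> 0" "s = p + q"
      using sr(1) by (rule pcoeff_times_nonzeroD)
    then have "p \<in> ?A" "q \<in> ?B" "r \<in> ?C" "l - M \<le> s"
      using x[of p] y[of q] z[of r] sr \<open>0 \<le> M\<close> unfolding trunc_supp_def a_def by auto
    then show "s \<in> S \<and> r \<in> ?C"
      unfolding S_def using pq(3) by (auto intro!: image_eqI[of _ _ "(p, q)"])
  qed (use fin finS in auto)
  also have "\<dots> = (\<Sum>s\<in>S. \<Sum>r\<in>?C. \<Sum>p\<in>?A. \<Sum>q\<in>?B.
      if s = p + q \<and> p + q + r = l then pcoeff x p * pcoeff y q * pcoeff z r else 0)"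
  proof (intro sum.cong refl)
    fix s r assume "s \<in> S" "r \<in> ?C"
    then have s: "l - M \<le> s" by (simp add: S_def)
    show "(if s + r = l then pcoeff (x * y) s * pcoeff z r else 0) = (\<Sum>p\<in>?A. \<Sum>q\<in>?B.
      if s = p + q \<and> p + q + r = l then pcoeff x p * pcoeff y q * pcoeff z r else 0)"
    proof (cases "s + r = l")
      case True
      have "(if p + q = s then b else 0) * c = (if s = p + q \<and> p + q + r = l then b * c else 0)"
        for p q and b c :: real using True by (cases "p + q = s") simp_all
      then show ?thesis unfolding if_P[OF True] xy[OF s] sum_distrib_right by (simp only:)
    next
      case False
      then have "(if s = p + q \<and> p + q + r = l then pcoeff x p * pcoeff y q * pcoeff z r else 0) = 0"
        for p q by simp
      with False show ?thesis by (simp only: if_False sum.neutral_const)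
    qed
  qed
  also have "\<dots> = (\<Sum>r\<in>?C. \<Sum>s\<in>S. \<Sum>p\<in>?A. \<Sum>q\<in>?B.
      if s = p + q \<and> p + q + r = l then pcoeff x p * pcoeff y q * pcoeff z r else 0)"
    by (rule sum.swap)
  also have "\<dots> = (\<Sum>r\<in>?C. \<Sum>p\<in>?A. \<Sum>s\<in>S. \<Sum>q\<in>?B.
      if s = p + q \<and> p + q + r = l then pcoeff x p * pcoeff y q * pcoeff z r else 0)"
    by (rule sum.cong[OF refl sum.swap])
  also have "\<dots> = (\<Sum>r\<in>?C. \<Sum>p\<in>?A. \<Sum>q\<in>?B. \<Sum>s\<in>S.
      if s = p + q \<and> p + q + r = l then pcoeff x p * pcoeff y q * pcoeff z r else 0)"
    by (rule sum.cong[OF refl sum.cong[OF refl sum.swap]])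
  also have "\<dots> = (\<Sum>r\<in>?C. \<Sum>p\<in>?A. \<Sum>q\<in>?B.
      if p + q + r = l then pcoeff x p * pcoeff y q * pcoeff z r else 0)"
  proof (intro sum.cong refl)
    fix r p q assume m: "r \<in> ?C" "p \<in> ?A" "q \<in> ?B"
    show "(\<Sum>s\<in>S. if s = p + q \<and> p + q + r = l then pcoeff x p * pcoeff y q * pcoeff z r else 0)
      = (if p + q + r = l then pcoeff x p * pcoeff y q * pcoeff z r else 0)"
    proof (cases "p + q + r = l")
      case True
      have "r \<le> M" using m z unfolding trunc_supp_def by auto
      then have "l - M \<le> p + q" using True by linarith
      then have "p + q \<in> S"
        unfolding S_def using m by (auto intro!: image_eqI[of _ _ "(p, q)"])
      then show ?thesis using finS True by (simp add: sum.delta)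
    qed auto
  qed
  also have "\<dots> = (\<Sum>p\<in>?A. \<Sum>r\<in>?C. \<Sum>q\<in>?B.
      if p + q + r = l then pcoeff x p * pcoeff y q * pcoeff z r else 0)"
    by (rule sum.swap)
  also have "\<dots> = (\<Sum>p\<in>?A. \<Sum>q\<in>?B. \<Sum>r\<in>?C.
      if p + q + r = l then pcoeff x p * pcoeff y q * pcoeff z r else 0)"
    by (rule sum.cong[OF refl sum.swap])
  finally show ?thesis .
qed

lemma puiseux_mult_assoc: "x * y * z = x * (y * (z :: puiseux))"
proof (rule puiseux_eqI)
  fix l
  obtain B where B: "\<And>l. pcoeff x l \<noteq> 0 \<Longrightarrow> l \<le> B" using pcoeff_bdd[of x] by blast
  obtain C where C: "\<And>l. pcoeff y l \<noteq> 0 \<Longrightarrow> l \<le> C" using pcoeff_bdd[of y] by blast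
  obtain D where D: "\<And>l. pcoeff z l \<noteq> 0 \<Longrightarrow> l \<le> D" using pcoeff_bdd[of z] by blast
  define M where "M = max 0 (max B (max C D))"
  have M: "0 \<le> M" "\<And>l. pcoeff x l \<noteq> 0 \<Longrightarrow> l \<le> M" "\<And>l. pcoeff y l \<noteq> 0 \<Longrightarrow> l \<le> M"
    "\<And>l. pcoeff z l \<noteq> 0 \<Longrightarrow> l \<le> M"
    using B C D unfolding M_def by fastforce+
  let ?a = "l - 2 * M"
  let ?A = "trunc_supp x ?a" and ?B = "trunc_supp y ?a" and ?C = "trunc_supp z ?a"
  have "pcoeff (x * (y * z)) l = pcoeff (y * z * x) l" by (simp add: puiseux_mult_commute)
  also have "\<dots> = (\<Sum>q\<in>?B. \<Sum>r\<in>?C. \<Sum>p\<in>?A.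
      if q + r + p = l then pcoeff y q * pcoeff z r * pcoeff x p else 0)"
    by (rule pcoeff_times_triple) (use M in auto)
  also have "\<dots> = (\<Sum>q\<in>?B. \<Sum>p\<in>?A. \<Sum>r\<in>?C.
      if q + r + p = l then pcoeff y q * pcoeff z r * pcoeff x p else 0)"
    by (rule sum.cong[OF refl sum.swap])
  also have "\<dots> = (\<Sum>p\<in>?A. \<Sum>q\<in>?B. \<Sum>r\<in>?C.
      if q + r + p = l then pcoeff y q * pcoeff z r * pcoeff x p else 0)"
    by (rule sum.swap)
  also have "\<dots> = (\<Sum>p\<in>?A. \<Sum>q\<in>?B. \<Sum>r\<in>?C.
      if p + q + r = l then pcoeff x p * pcoeff y q * pcoeff z r else 0)"
    by (intro sum.cong refl) (simp add: ac_simps)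
  also have "\<dots> = pcoeff (x * y * z) l"
    by (rule pcoeff_times_triple[symmetric]) (use M in auto)
  finally show "pcoeff (x * y * z) l = pcoeff (x * (y * z)) l" by simp
qed

instance puiseux :: comm_ring_1
proof
  fix x y z :: puiseux
  show "x * y * z = x * (y * z)" by (rule puiseux_mult_assoc)
  show "x * y = y * x" by (rule puiseux_mult_commute)
  show "1 * x = x"
  proof (rule puiseux_eqI)
    fix l
    have "pcoeff (1 * x) l = (\<Sum>p\<in>{0}. pcoeff 1 p * pcoeff x (l - p))"
      by (rule pcoeff_times_superset) (auto simp: pcoeff_one split: if_splits)
    then show "pcoeff (1 * x) l = pcoeff x l" by (simp add: pcoeff_one)
  qed
  show "(x + y) * z = x * z + y * z"
  proof (rule puiseux_eqI)
    fix l
    let ?A = "{p. pcoeff x p \<noteq> 0 \<and> pcoeff z (l - p) \<noteq> 0} \<union> {p. pcoeff y p \<noteq> 0 \<and> pcoeff z (l - p) \<noteq> 0}"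
    have fin: "finite ?A" by (simp add: mult_support_finite)
    have "pcoeff ((x + y) * z) l = (\<Sum>p\<in>?A. pcoeff (x + y) p * pcoeff z (l - p))"
      using fin by (rule pcoeff_times_superset) auto
    moreover have "pcoeff (x * z) l = (\<Sum>p\<in>?A. pcoeff x p * pcoeff z (l - p))"
      using fin by (rule pcoeff_times_superset) auto
    moreover have "pcoeff (y * z) l = (\<Sum>p\<in>?A. pcoeff y p * pcoeff z (l - p))"
      using fin by (rule pcoeff_times_superset) auto
    ultimately show "pcoeff ((x + y) * z) l = pcoeff (x * z + y * z) l"
      by (simp add: algebra_simps sum.distrib)
  qed
  have "pcoeff 0 0 \<noteq> pcoeff 1 0" by (simp add: pcoeff_one)
  then show "(0 :: puiseux) \<noteq> 1" by metis
qed (rule puiseux_eqI, simp)+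

definition lead_exp :: "puiseux \<Rightarrow> real" where
  "lead_exp x = (GREATEST l. pcoeff x l \<noteq> 0)"

definition lc :: "puiseux \<Rightarrow> real" where
  "lc x = (if x = 0 then 0 else pcoeff x (lead_exp x))"

definition val :: "puiseux \<Rightarrow> ereal" where
  "val x = (if x = 0 then -\<infinity> else ereal (lead_exp x))"

lemma lead_exp_eqI:
  assumes "pcoeff x d \<noteq> 0" "\<And>l. pcoeff x l \<noteq> 0 \<Longrightarrow> l \<le> d"
  shows "lead_exp x = d"
  unfolding lead_exp_def using assms by (rule Greatest_equality)

lemma lead_exp:
  assumes "x \<noteq> 0"
  shows "pcoeff x (lead_exp x) \<noteq> 0" "\<And>l. pcoeff x l \<noteq> 0 \<Longrightarrow> l \<le> lead_exp x"
proof -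
  obtain s where s: "pcoeff x s \<noteq> 0" using assms puiseux_eqI[of x 0] by auto
  let ?F = "{l. pcoeff x l \<noteq> 0 \<and> s \<le> l}"
  have F: "finite ?F" "?F \<noteq> {}" using pcoeff_finite s by auto
  then have m: "Max ?F \<in> ?F" by (rule Max_in)
  have le: "l \<le> Max ?F" if "pcoeff x l \<noteq> 0" for l
  proof (cases "s \<le> l")
    case True
    then show ?thesis using F that by simp
  next
    case False
    then show ?thesis using m by simp
  qed
  have eq: "lead_exp x = Max ?F" using m le by (intro lead_exp_eqI) auto
  show "pcoeff x (lead_exp x) \<noteq> 0" using m eq by simp
  show "\<And>l. pcoeff x l \<noteq> 0 \<Longrightarrow> l \<le> lead_exp x" using le eq by simp
qed

lemma lc_eqI:
  assumes "pcoeff x d \<noteq> 0" "\<And>l. pcoeff x l \<noteq> 0 \<Longrightarrow> l \<le> d"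
  shows "lc x = pcoeff x d"
  using lead_exp_eqI[OF assms] assms(1) by (auto simp: lc_def)

lemma lc_zero [simp]: "lc 0 = 0" by (simp add: lc_def)

lemma lc_eq_0_iff [simp]: "lc x = 0 \<longleftrightarrow> x = 0"
  using lead_exp(1) by (auto simp: lc_def)

lemma lc_uminus [simp]: "lc (- x) = - lc x"
proof (cases "x = 0")
  case False
  have "lc (- x) = pcoeff (- x) (lead_exp x)"
    by (rule lc_eqI) (use lead_exp[OF False] in auto)
  then show ?thesis using False by (simp add: lc_def)
qed simp

lemma mult_lead:
  assumes "x \<noteq> 0" "y \<noteq> 0"
  shows "pcoeff (x * y) (lead_exp x + lead_exp y) = lc x * lc y"
    and "\<And>l. pcoeff (x * y) l \<noteq> 0 \<Longrightarrow> l \<le> lead_exp x + lead_exp y"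
proof -
  have "pcoeff (x * y) (lead_exp x + lead_exp y)
    = (\<Sum>p\<in>{lead_exp x}. pcoeff x p * pcoeff y (lead_exp x + lead_exp y - p))"
  proof (rule pcoeff_times_superset)
    fix p assume "pcoeff x p \<noteq> 0" "pcoeff y (lead_exp x + lead_exp y - p) \<noteq> 0"
    then show "p \<in> {lead_exp x}" using lead_exp(2)[OF assms(1)] lead_exp(2)[OF assms(2)] by fastforce
  qed simp
  then show "pcoeff (x * y) (lead_exp x + lead_exp y) = lc x * lc y" using assms by (simp add: lc_def)
  fix l assume "pcoeff (x * y) l \<noteq> 0"
  then obtain p q where "pcoeff x p \<noteq> 0" "pcoeff y q \<noteq> 0" "l = p + q" by (rule pcoeff_times_nonzeroD)
  then show "l \<le> lead_exp x + lead_exp y"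
    using lead_exp(2)[OF assms(1), of p] lead_exp(2)[OF assms(2), of q] by simp
qed

lemma lc_mult: "lc (x * y) = lc x * lc y"
proof (cases "x = 0 \<or> y = 0")
  case False
  then show ?thesis
    using mult_lead[of x y] lc_eqI[of "x * y" "lead_exp x + lead_exp y"] by simp
qed auto

lemma lc_add_pos:
  assumes "0 < lc x" "0 < lc y"
  shows "0 < lc (x + y)"
proof -
  have nz: "x \<noteq> 0" "y \<noteq> 0" using assms by auto
  let ?d = "max (lead_exp x) (lead_exp y)"
  have x: "0 \<le> pcoeff x ?d"
  proof (cases "pcoeff x ?d = 0")
    case False
    then have "?d = lead_exp x" using lead_exp(2)[OF nz(1), of ?d] by simp
    then show ?thesis using assms(1) nz(1) by (simp add: lc_def)
  qed simp
  have y: "0 \<le> pcoeff y ?d"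
  proof (cases "pcoeff y ?d = 0")
    case False
    then have "?d = lead_exp y" using lead_exp(2)[OF nz(2), of ?d] by simp
    then show ?thesis using assms(2) nz(2) by (simp add: lc_def)
  qed simp
  have "0 < pcoeff x ?d \<or> 0 < pcoeff y ?d"
    using assms nz by (auto simp: lc_def max_def)
  then have pos: "0 < pcoeff (x + y) ?d" using x y by auto
  have "lc (x + y) = pcoeff (x + y) ?d"
  proof (rule lc_eqI)
    fix l assume "pcoeff (x + y) l \<noteq> 0"
    then have "pcoeff x l \<noteq> 0 \<or> pcoeff y l \<noteq> 0" by auto
    then show "l \<le> ?d" using lead_exp(2)[OF nz(1)] lead_exp(2)[OF nz(2)] by fastforce
  qed (use pos in simp)
  with pos show ?thesis by simp
qed

instantiation puiseux :: linordered_idom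
begin

definition less_eq_puiseux :: "puiseux \<Rightarrow> puiseux \<Rightarrow> bool" where
  "x \<le> y \<longleftrightarrow> 0 \<le> lc (y - x)"

definition less_puiseux :: "puiseux \<Rightarrow> puiseux \<Rightarrow> bool" where
  "x < y \<longleftrightarrow> 0 < lc (y - x)"

definition abs_puiseux :: "puiseux \<Rightarrow> puiseux" where
  "\<bar>x :: puiseux\<bar> = (if x < 0 then - x else x)"

definition sgn_puiseux :: "puiseux \<Rightarrow> puiseux" where
  "sgn (x :: puiseux) = (if x = 0 then 0 else if 0 < x then 1 else - 1)"

instance
proof
  fix x y z :: puiseux
  have lc_swap: "lc (a - b) = - lc (b - a)" for a b
    using lc_uminus[of "b - a"] by simp
  have le_iff: "a \<le> b \<longleftrightarrow> a < b \<or> a = b" for a b :: puiseux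
    unfolding less_eq_puiseux_def less_puiseux_def using lc_eq_0_iff[of "b - a"]
    by (auto simp: less_le simp del: lc_eq_0_iff)
  have less_trans: "a < b \<Longrightarrow> b < c \<Longrightarrow> a < c" for a b c :: puiseux
    unfolding less_puiseux_def using lc_add_pos[of "b - a" "c - b"] by simp
  show lt: "x < y \<longleftrightarrow> x \<le> y \<and> \<not> y \<le> x"
    unfolding less_eq_puiseux_def less_puiseux_def using lc_swap[of x y] by auto
  show "x \<le> x" by (simp add: le_iff)
  show "x \<le> z" if "x \<le> y" "y \<le> z" using that le_iff less_trans by metis
  show "x = y" if "x \<le> y" "y \<le> x" using that lt le_iff by blast
  show "x \<le> y \<or> y \<le> x"
    unfolding less_eq_puiseux_def using lc_swap[of x y] by auto
  show "z + x \<le> z + y" if "x \<le> y" using that by (simp add: less_eq_puiseux_def)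
  show "z * x < z * y" if "x < y" "0 < z"
  proof -
    have "0 < lc z * lc (y - x)" using that by (simp add: less_puiseux_def)
    then have "0 < lc (z * (y - x))" by (simp add: lc_mult)
    then show ?thesis by (simp add: less_puiseux_def right_diff_distrib)
  qed
  show "\<bar>x\<bar> = (if x < 0 then - x else x)" by (rule abs_puiseux_def)
  show "sgn x = (if x = 0 then 0 else if 0 < x then 1 else - 1)" by (rule sgn_puiseux_def)
qed

end

lift_definition puiseux_monom :: "real \<Rightarrow> real \<Rightarrow> puiseux" is "\<lambda>c a l. if l = a then c else 0"
  by (auto simp: puiseux_supp_def)

lemma pcoeff_monom: "pcoeff (puiseux_monom c a) l = (if l = a then c else 0)"
  by transfer simp

lemma puiseux_inverse_neg:
  fixes u :: puiseux
  assumes d: "0 < d" and u: "\<And>l. pcoeff u l \<noteq> 0 \<Longrightarrow> l \<le> - d"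
  shows "\<exists>y. (1 - u) * y = 1"
proof -
  have pow: "pcoeff (u ^ k) l \<noteq> 0 \<Longrightarrow> l \<le> - (real k * d)" for k l
  proof (induction k arbitrary: l)
    case 0
    then show ?case by (simp add: pcoeff_one split: if_splits)
  next
    case (Suc k)
    then have "pcoeff (u * u ^ k) l \<noteq> 0" by simp
    then obtain p q where "pcoeff u p \<noteq> 0" "pcoeff (u ^ k) q \<noteq> 0" "l = p + q"
      by (rule pcoeff_times_nonzeroD)
    then show ?case using u[of p] Suc.IH[of q] by (simp add: algebra_simps)
  qed
  have pow0: "pcoeff (u ^ k) l = 0" if "- l < real k * d" for k l
    using pow[of k l] that by auto
  define S where "S n = (\<Sum>k<n. u ^ k)" for n
  have S: "pcoeff (S n) l = (\<Sum>k<n. pcoeff (u ^ k) l)" for n l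
    unfolding S_def by (induction n) auto
  define N where "N l = Suc (nat \<lceil>- l / d\<rceil>)" for l
  have N: "- l < real n * d" if "N l \<le> n" for l n
  proof -
    have "- l / d < real (N l)" unfolding N_def by linarith
    also have "\<dots> \<le> real n" using that by simp
    finally have "- l / d < real n" .
    then show ?thesis by (simp only: pos_divide_less_eq[OF d])
  qed
  have mono: "N m \<le> N l" if "l \<le> m" for l m
    unfolding N_def using that d
    by (intro Suc_le_mono[THEN iffD2] nat_mono ceiling_mono divide_right_mono) auto
  have stab: "pcoeff (S n) l = pcoeff (S (N l)) l" if "N l \<le> n" for n l
    unfolding S
  proof (rule sum.mono_neutral_right)
    show "\<forall>i\<in>{..<n} - {..<N l}. pcoeff (u ^ i) l = 0"
    proof
      fix i assume "i \<in> {..<n} - {..<N l}"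
      then have "N l \<le> i" by simp
      then show "pcoeff (u ^ i) l = 0" by (intro pow0 N)
    qed
  qed (use that in auto)
  define g where "g l = pcoeff (S (N l)) l" for l
  have "puiseux_supp {l. g l \<noteq> 0}"
    unfolding puiseux_supp_iff
  proof
    fix a
    have "{l \<in> {l. g l \<noteq> 0}. a \<le> l} \<subseteq> {l. pcoeff (S (N a)) l \<noteq> 0 \<and> a \<le> l}"
    proof
      fix l assume l: "l \<in> {l \<in> {l. g l \<noteq> 0}. a \<le> l}"
      then have "pcoeff (S (N a)) l = g l" unfolding g_def by (intro stab mono) simp
      with l show "l \<in> {l. pcoeff (S (N a)) l \<noteq> 0 \<and> a \<le> l}" by simp
    qed
    then show "finite {l \<in> {l. g l \<noteq> 0}. a \<le> l}" by (rule finite_subset) (rule pcoeff_finite)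
  qed
  then have g: "pcoeff (Abs_puiseux g) l = g l" for l by (simp add: Abs_puiseux_inverse)
  have "(1 - u) * Abs_puiseux g = 1"
  proof (rule puiseux_eqI)
    fix l
    have eq: "g (l - p) = pcoeff (S (N l)) (l - p)" if "pcoeff (1 - u) p \<noteq> 0" for p
    proof -
      have "p \<le> 0" using that u[of p] d by (auto simp: pcoeff_one split: if_splits)
      then have "N (l - p) \<le> N l" by (intro mono) simp
      then show ?thesis unfolding g_def by (rule stab[symmetric])
    qed
    have set: "{p. pcoeff (1 - u) p \<noteq> 0 \<and> g (l - p) \<noteq> 0}
        = {p. pcoeff (1 - u) p \<noteq> 0 \<and> pcoeff (S (N l)) (l - p) \<noteq> 0}"
      by (rule Collect_cong) (metis eq)
    have "pcoeff ((1 - u) * Abs_puiseux g) l = pcoeff ((1 - u) * S (N l)) l"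
      unfolding pcoeff_times g set by (rule sum.cong[OF refl]) (metis (mono_tags, lifting) eq mem_Collect_eq)
    also have "\<dots> = pcoeff (1 - u ^ N l) l" by (simp add: S_def one_diff_power_eq)
    also have "\<dots> = pcoeff 1 l" using pow0[OF N[OF order_refl]] by simp
    finally show "pcoeff ((1 - u) * Abs_puiseux g) l = pcoeff 1 l" .
  qed
  then show ?thesis ..
qed

lemma puiseux_inverse_ex:
  fixes x :: puiseux
  assumes "x \<noteq> 0"
  shows "\<exists>y. x * y = 1"
proof -
  define m where "m = puiseux_monom (1 / lc x) (- lead_exp x)"
  have lcx: "lc x \<noteq> 0" using assms by simp
  have cm: "pcoeff m (- lead_exp x) = 1 / lc x" by (simp add: m_def pcoeff_monom)
  then have m0: "m \<noteq> 0" using lcx by auto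
  have lem: "lead_exp m = - lead_exp x"
    by (rule lead_exp_eqI) (use lcx in \<open>auto simp: m_def pcoeff_monom split: if_splits\<close>)
  then have lcm: "lc m = 1 / lc x" using m0 cm by (simp add: lc_def)
  define u where "u = 1 - x * m"
  have lead: "pcoeff (x * m) 0 = 1" "\<And>l. pcoeff (x * m) l \<noteq> 0 \<Longrightarrow> l \<le> 0"
    using mult_lead[OF assms m0] lem lcm lcx by auto
  have neg: "l < 0" if "pcoeff u l \<noteq> 0" for l
    using that lead(1) lead(2)[of l] by (auto simp: u_def pcoeff_one split: if_splits)
  have "\<exists>d>0. \<forall>l. pcoeff u l \<noteq> 0 \<longrightarrow> l \<le> - d"
  proof (cases "u = 0")
    case True
    then show ?thesis by (intro exI[of _ 1]) simp
  next
    case False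
    then show ?thesis using lead_exp[OF False] neg by (intro exI[of _ "- lead_exp u"]) auto
  qed
  then obtain y where "(1 - u) * y = 1" using puiseux_inverse_neg by blast
  then have "x * (m * y) = 1" by (simp add: u_def mult.assoc)
  then show ?thesis ..
qed

instantiation puiseux :: linordered_field
begin

definition inverse_puiseux :: "puiseux \<Rightarrow> puiseux" where
  "inverse (x :: puiseux) = (if x = 0 then 0 else (THE y. x * y = 1))"

definition divide_puiseux :: "puiseux \<Rightarrow> puiseux \<Rightarrow> puiseux" where
  "x div y = x * inverse (y :: puiseux)"

instance
proof
  fix x y :: puiseux
  show "inverse x * x = 1" if "x \<noteq> 0"
  proof -
    have "\<exists>!y. x * y = 1"
      using puiseux_inverse_ex[OF that] that by (metis mult_left_cancel)
    then have "x * (THE y. x * y = 1) = 1" by (rule theI')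
    then show ?thesis using that by (simp add: inverse_puiseux_def mult.commute)
  qed
  show "x div y = x * inverse y" by (rule divide_puiseux_def)
  show "inverse 0 = (0 :: puiseux)" by (simp add: inverse_puiseux_def)
qed

end


section \<open>Signed tropical numbers\<close>

text \<open>
  The tropical numbers are the elements of \<^typ>\<open>ereal\<close> other than \<open>\<infinity>\<close>;
  the sets of tropical points below carry this side condition explicitly.
\<close>

datatype signed_trop = TPos real | TNeg real | TZero

fun modulus :: "signed_trop \<Rightarrow> ereal" where
  "modulus (TPos a) = ereal a"
| "modulus (TNeg a) = ereal a"
| "modulus TZero = -\<infinity>"

text \<open>
  The index sets \<open>[n]\<close> and \<open>[m]\<close> are rendered as finite types \<open>'n\<close> and \<open>'m\<close>,
  the latter linearly ordered because pairs \<open>i < j\<close> of matrix indices are used.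
\<close>

definition trop_points :: "(ereal ^ 'n) set" where
  "trop_points = {x. \<forall>k. x $ k \<noteq> \<infinity>}"

definition sval :: "puiseux \<Rightarrow> signed_trop" where
  "sval x = (if x = 0 then TZero
             else if 0 < x then TPos (lead_exp x) else TNeg (lead_exp x))"

lemma modulus_sval: "modulus (sval x) = val x"
  by (simp add: sval_def val_def)

definition sval_matrix :: "puiseux ^ 'm ^ 'm \<Rightarrow> signed_trop ^ 'm ^ 'm" where
  "sval_matrix Q = (\<chi> i j. sval (Q $ i $ j))"


section \<open>Spectrahedra over the series and their tropical counterparts\<close>

definition psd :: "puiseux ^ 'm ^ 'm \<Rightarrow> bool" where
  "psd A \<longleftrightarrow> transpose A = A \<and>
     (\<forall>v :: puiseux ^ 'm. 0 \<le> (\<Sum>i\<in>UNIV. \<Sum>j\<in>UNIV. v $ i * A $ i $ j * v $ j))"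

definition spectrahedron :: "('n \<Rightarrow> puiseux ^ 'm ^ 'm) \<Rightarrow> (puiseux ^ 'n) set" where
  "spectrahedron Q = {x. (\<forall>k. 0 \<le> x $ k) \<and> psd (\<chi> i j. \<Sum>k\<in>UNIV. x $ k * Q k $ i $ j)}"

text \<open>The suprema below are maxima over finite sets; the supremum of the empty set in \<^typ>\<open>ereal\<close> is \<open>-\<infinity>\<close>.\<close>

definition Qplus :: "('n::finite \<Rightarrow> signed_trop ^ 'm ^ 'm) \<Rightarrow> 'm \<Rightarrow> 'm \<Rightarrow> ereal ^ 'n \<Rightarrow> ereal" where
  "Qplus Q i j x = (SUP k\<in>{k. Q k $ i $ j \<in> range TPos}. modulus (Q k $ i $ j) + x $ k)"

definition Qminus :: "('n::finite \<Rightarrow> signed_trop ^ 'm ^ 'm) \<Rightarrow> 'm \<Rightarrow> 'm \<Rightarrow> ereal ^ 'n \<Rightarrow> ereal" where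
  "Qminus Q i j x = (SUP k\<in>{k. Q k $ i $ j \<in> range TNeg}. modulus (Q k $ i $ j) + x $ k)"

definition trop_spectrahedron ::
  "('n::finite \<Rightarrow> signed_trop ^ 'm::{finite,linorder} ^ 'm::{finite,linorder}) \<Rightarrow> (ereal ^ 'n) set" where
  "trop_spectrahedron Q = {x \<in> trop_points.
     (\<forall>i. Qplus Q i i x \<ge> Qminus Q i i x) \<and>
     (\<forall>i j. i < j \<longrightarrow>
        Qplus Q i i x + Qplus Q j j x \<ge> 2 * max (Qplus Q i j x) (Qminus Q i j x) \<or>
        Qplus Q i j x = Qminus Q i j x)}"

definition upper_pairs :: "('m::linorder \<times> 'm) set" where
  "upper_pairs = {(i, j). i < j}"

definition trop_piece ::
  "('m::{finite,linorder} \<times> 'm) set \<Rightarrow> ('m \<times> 'm \<Rightarrow> ereal \<Rightarrow> ereal \<Rightarrow> bool) \<Rightarrow>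
   ('n::finite \<Rightarrow> signed_trop ^ 'm::{finite,linorder} ^ 'm::{finite,linorder}) \<Rightarrow> (ereal ^ 'n) set" where
  "trop_piece \<Sigma> R Q = {x \<in> trop_points.
     (\<forall>i. Qplus Q i i x \<ge> Qminus Q i i x) \<and>
     (\<forall>(i, j) \<in> \<Sigma>. Qplus Q i i x + Qplus Q j j x \<ge> 2 * max (Qplus Q i j x) (Qminus Q i j x)) \<and>
     (\<forall>(i, j) \<in> upper_pairs - \<Sigma>. R (i, j) (Qplus Q i j x) (Qminus Q i j x))}"

definition trop_support :: "ereal ^ 'n \<Rightarrow> 'n set" where
  "trop_support x = {k. x $ k \<noteq> -\<infinity>}"

text \<open>
  Points of \<open>\<real>\<^sup>K\<close> are the functions in \<open>K \<rightarrow>\<^sub>E UNIV\<close>; for finite \<open>K\<close>, the product topology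
  \<open>powertop_real K\<close> on them is the Euclidean one.
\<close>

definition stratum :: "'n set \<Rightarrow> (ereal ^ 'n) set \<Rightarrow> ('n \<Rightarrow> real) set" where
  "stratum K S = {(\<lambda>k\<in>K. real_of_ereal (x $ k)) | x. x \<in> S \<and> trop_support x = K}"

definition regular_in :: "'a topology \<Rightarrow> 'a set \<Rightarrow> bool" where
  "regular_in X S \<longleftrightarrow> closedin X S \<and> S = X closure_of (X interior_of S)"

end

theory Submission
  imports Defs
begin

text \<open>
  Write \<open>A\<close> for the matrix \<open>\<Sum>\<^sub>k X\<^sub>k Q\<^sup>k\<close> of size \<open>m\<close>, and \<open>x\<close> for the valuation of \<open>X\<close>. On nonnegative series
  the valuation turns sums into maxima, so \<open>Q\<^sup>+\<^sub>i\<^sub>j(x)\<close> and \<open>Q\<^sup>-\<^sub>i\<^sub>j(x)\<close> are the valuations of the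
  positive and the negative part of the entry \<open>A\<^sub>i\<^sub>j\<close>. If they differ, no cancellation takes
  place and their maximum is the valuation of \<open>A\<^sub>i\<^sub>j\<close>. The inequalities \<open>A\<^sub>i\<^sub>i \<ge> 0\<close> and
  \<open>A\<^sub>i\<^sub>j\<^sup>2 \<le> A\<^sub>i\<^sub>i A\<^sub>j\<^sub>j\<close>, which hold for positive semidefinite \<open>A\<close>, then give the inclusion from
  left to right (\<open>val_spectrahedron_subset\<close>).

  For the other inclusion, a symmetric matrix with nonnegative diagonal is positive semidefinite
  as soon as \<open>(m A\<^sub>i\<^sub>j)\<^sup>2 \<le> A\<^sub>i\<^sub>i A\<^sub>j\<^sub>j\<close> for \<open>i \<noteq> j\<close> (\<open>psd_if_strong_minors\<close>). Let \<open>x\<close> be a point of the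
  tropical set, let \<open>\<Sigma>\<close> be the set of pairs satisfying the first alternative, and let \<open>F\<close> be the
  set of remaining pairs, on which \<open>Q\<^sup>+\<^sub>i\<^sub>j(x) = Q\<^sup>-\<^sub>i\<^sub>j(x)\<close>. The nonnegative points \<open>X\<close> of valuation \<open>x\<close>
  with \<open>A\<^sub>i\<^sub>i \<ge> 0\<close> for all \<open>i\<close> and \<open>(m A\<^sub>i\<^sub>j)\<^sup>2 \<le> A\<^sub>i\<^sub>i A\<^sub>j\<^sub>j\<close> for \<open>(i, j) \<in> \<Sigma>\<close> form a set that is convex over the
  field of series. A convex set on which finitely many linear forms attain every pattern of weak
  signs contains a common zero of them (\<open>common_zero_of_sign_patterns\<close>). Applied to the forms
  \<open>A\<^sub>i\<^sub>j\<close> with \<open>(i, j) \<in> F\<close>, this gives a point where \<open>A\<^sub>i\<^sub>j = 0\<close> on \<open>F\<close>, and there \<open>A\<close> is positive semidefinite.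

  It remains to realise each sign pattern on \<open>F\<close> by a lift of \<open>x\<close>. The pattern selects a piece
  that contains \<open>x\<close>, and by regularity of the stratum there are points \<open>y\<close> of this piece
  arbitrarily close to \<open>x\<close> without tropical ties between terms in different variables
  (\<open>generic_point_near\<close>); ties in a single variable are excluded by the condition on the
  diagonal entries (\<open>no_diagonal_tie\<close>). The lift
  is \<open>X\<^sub>k = s\<^bsup>y\<^sub>k - x\<^sub>k\<^esup> t\<^bsup>x\<^sub>k\<^esup>\<close> for a large real number \<open>s\<close>. Its valuation is exactly \<open>x\<close>, while the
  powers of \<open>s\<close> break the ties at \<open>x\<close> in the way they are broken at \<open>y\<close>. Hence each entry of \<open>A\<close>
  is close to its dominant term at \<open>y\<close>, and every strict tropical inequality at \<open>y\<close> becomes an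
  inequality between series that holds with as large a factor as desired
  (\<open>lift_generic_point\<close>).
\<close>

section \<open>The valuation\<close>

lemma lead_exp_mult:
  assumes "x \<noteq> 0" "y \<noteq> 0"
  shows "lead_exp (x * y) = lead_exp x + lead_exp y"
  using mult_lead[OF assms] assms by (intro lead_exp_eqI) auto

lemma val_mult: "val (x * y) = val x + val y"
  by (auto simp: val_def lead_exp_mult)

lemma lead_exp_uminus [simp]: "lead_exp (- x) = lead_exp x"
  by (simp add: lead_exp_def)

lemma val_uminus [simp]: "val (- x) = val x"
  by (simp add: val_def)

lemma lead_exp_abs [simp]: "lead_exp \<bar>x\<bar> = lead_exp x"
  by (simp add: abs_if)

lemma puiseux_pos_iff: "0 < x \<longleftrightarrow> 0 < lc x"
  by (simp add: less_puiseux_def)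

lemma lc_abs [simp]: "lc \<bar>x\<bar> = \<bar>lc x\<bar>"
proof (cases x "0 :: puiseux" rule: linorder_cases)
  case less
  then show ?thesis using puiseux_pos_iff[of "- x"] by simp
next
  case greater
  then show ?thesis using puiseux_pos_iff[of x] by simp
qed simp

lemma puiseux_less_lex:
  assumes "0 < b" and "lead_exp a < lead_exp b \<or> lead_exp a = lead_exp b \<and> lc a < lc b"
  shows "a < b"
proof (cases "a = 0")
  case False
  let ?d = "lead_exp b"
  have b: "b \<noteq> 0" "0 < lc b" using assms(1) by (auto simp: puiseux_pos_iff)
  have "pcoeff a ?d < pcoeff b ?d"
    using assms(2)
  proof
    assume "lead_exp a < ?d"
    then have "pcoeff a ?d = 0" using lead_exp(2)[OF False] by force
    then show ?thesis using b by (simp add: lc_def)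
  next
    assume "lead_exp a = ?d \<and> lc a < lc b"
    then show ?thesis using b False by (metis lc_def)
  qed
  then have pos: "0 < pcoeff (b - a) ?d" by simp
  have "lc (b - a) = pcoeff (b - a) ?d"
  proof (rule lc_eqI)
    fix l assume "pcoeff (b - a) l \<noteq> 0"
    then have "pcoeff b l \<noteq> 0 \<or> pcoeff a l \<noteq> 0" by auto
    then show "l \<le> ?d" using lead_exp(2)[OF b(1)] lead_exp(2)[OF False] assms(2) by fastforce
  qed (use pos in simp)
  then show ?thesis using pos by (simp add: less_puiseux_def)
qed (use assms in simp)

lemma val_mono:
  assumes "0 \<le> x" "x \<le> y"
  shows "val x \<le> val y"
proof (rule ccontr)
  assume "\<not> val x \<le> val y"
  then have "x \<noteq> 0" "y = 0 \<or> lead_exp y < lead_exp x"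
    by (auto simp: val_def split: if_splits)
  then have "y < x" using assms(1) puiseux_less_lex[of x y] by (auto simp: less_le)
  then show False using assms(2) by simp
qed

lemma val_double: "val (x + x) = val x"
proof (cases "x = 0")
  case False
  have "pcoeff (x + x) l = 2 * pcoeff x l" for l unfolding pcoeff_plus by simp
  then have "lead_exp (x + x) = lead_exp x" unfolding lead_exp_def by simp
  then show ?thesis using False by (simp add: val_def)
qed simp

lemma val_add_nonneg:
  assumes "0 \<le> x" "0 \<le> y"
  shows "val (x + y) = max (val x) (val y)"
proof (rule antisym)
  have *: "val (a + b) \<le> max (val a) (val b)" if "0 \<le> a" "a \<le> b" for a b
  proof -
    have "val (a + b) \<le> val (b + b)" using that by (intro val_mono) auto
    then show ?thesis unfolding val_double by (simp add: le_max_iff_disj)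
  qed
  show "val (x + y) \<le> max (val x) (val y)"
    using *[of x y] *[of y x] assms by (cases "x \<le> y") (auto simp: add.commute max.commute)
  show "max (val x) (val y) \<le> val (x + y)"
    using assms by (auto intro: val_mono)
qed

lemma val_sum_nonneg:
  assumes "finite S" "\<And>k. k \<in> S \<Longrightarrow> 0 \<le> f k"
  shows "val (\<Sum>k\<in>S. f k) = (SUP k\<in>S. val (f k))"
  using assms
proof (induction S)
  case empty
  then show ?case by (simp add: val_def bot_ereal_def)
next
  case (insert k S)
  then show ?case by (simp add: val_add_nonneg sum_nonneg sup_max)
qed

text \<open>
  Cancellation of leading terms requires equal valuations.
\<close>

lemma val_diff_nonneg:
  assumes "0 \<le> x" "0 \<le> y" "val x \<noteq> val y"
  shows "val (x - y) = max (val x) (val y)"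
proof -
  have *: "val (a - b) = max (val a) (val b)" if "0 \<le> b" "b \<le> a" "val a \<noteq> val b" for a b
    using val_add_nonneg[of "a - b" b] val_mono[of b a] that by (auto simp: max_def split: if_splits)
  show ?thesis
  proof (cases "y \<le> x")
    case True
    then show ?thesis using * assms by simp
  next
    case False
    then have "val (y - x) = max (val y) (val x)" using assms by (intro *) auto
    then show ?thesis using val_uminus[of "y - x"] by (simp add: max.commute)
  qed
qed

lemma pcoeff_of_nat: "pcoeff (of_nat n) l = (if l = 0 then real n else 0)"
  by (induction n) (auto simp: pcoeff_one)

lemma lead_exp_of_nat: "0 < n \<Longrightarrow> lead_exp (of_nat n) = 0"
  by (rule lead_exp_eqI) (auto simp: pcoeff_of_nat split: if_splits)

lemma lc_of_nat: "lc (of_nat n) = real n"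
  by (cases "n = 0") (simp_all add: lc_def lead_exp_of_nat pcoeff_of_nat)

lemma lead_exp_monom: "c \<noteq> 0 \<Longrightarrow> lead_exp (puiseux_monom c a) = a"
  by (rule lead_exp_eqI) (auto simp: pcoeff_monom split: if_splits)

lemma puiseux_monom_eq_0_iff [simp]: "puiseux_monom c a = 0 \<longleftrightarrow> c = 0"
proof
  assume "puiseux_monom c a = 0"
  then have "pcoeff (puiseux_monom c a) a = 0" by simp
  then show "c = 0" by (simp add: pcoeff_monom)
qed (simp add: puiseux_eqI pcoeff_monom)

lemma lc_monom: "lc (puiseux_monom c a) = c"
  by (simp add: lc_def lead_exp_monom pcoeff_monom)

section \<open>Positive semidefinite matrices\<close>

text \<open>
  The test vector \<open>(b, -e)\<close> gives \<open>b (a b - e\<^sup>2) \<ge> 0\<close>, which settles the case \<open>b \<noteq> 0\<close>. For \<open>b = 0\<close> the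
  form is affine in \<open>r\<close>, so a large \<open>r\<close> forces \<open>e = 0\<close>.
\<close>

lemma quadratic_form_two_minor:
  fixes a b e :: "'a::linordered_field"
  assumes form: "\<And>p r. 0 \<le> a * p\<^sup>2 + 2 * e * p * r + b * r\<^sup>2"
  shows "0 \<le> a" "e\<^sup>2 \<le> a * b"
proof -
  show a: "0 \<le> a" using form[of 1 0] by simp
  have b: "0 \<le> b" using form[of 0 1] by simp
  show "e\<^sup>2 \<le> a * b"
  proof (cases "b = 0")
    case True
    have "0 \<le> - (e\<^sup>2 * (a + 2))"
      using form[of "- e" "a + 1"] True by (simp add: algebra_simps power2_eq_square)
    moreover have "0 < a + 2" using a by simp
    ultimately have "e\<^sup>2 \<le> 0" by (simp add: mult_le_0_iff)
    then show ?thesis using True by simp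
  next
    case False
    have "0 \<le> b * (a * b - e\<^sup>2)"
      using form[of b "- e"] by (simp add: algebra_simps power2_eq_square)
    then show ?thesis using b False by (simp add: zero_le_mult_iff)
  qed
qed

lemma psd_minors:
  fixes A :: "puiseux ^ 'm ^ 'm"
  assumes "psd A"
  shows "0 \<le> A $ i $ i" "i \<noteq> j \<Longrightarrow> (A $ i $ j)\<^sup>2 \<le> A $ i $ i * A $ j $ j"
proof -
  have form: "0 \<le> (\<Sum>i\<in>UNIV. \<Sum>j\<in>UNIV. v $ i * A $ i $ j * v $ j)" for v
    using assms by (simp add: psd_def)
  have sym: "A $ i $ j = A $ j $ i" for i j
    using assms unfolding psd_def by (metis (mono_tags, lifting) transpose_def vec_lambda_beta)
  have nested: "0 \<le> (\<Sum>k\<in>UNIV. v $ k * (\<Sum>l\<in>UNIV. v $ l * A $ k $ l))" for v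
    using form[of v] by (simp only: sum_distrib_left ac_simps)
  show "0 \<le> A $ i $ i" for i
  proof -
    have "(\<Sum>k\<in>UNIV. axis i 1 $ k * f k) = f i" for f :: "'m \<Rightarrow> puiseux"
    proof -
      have "(\<Sum>k\<in>UNIV. axis i 1 $ k * f k) = (\<Sum>k\<in>{i}. axis i 1 $ k * f k)"
        by (rule sum.mono_neutral_right) (auto simp: axis_def)
      then show ?thesis by (simp add: axis_def)
    qed
    then show ?thesis using nested[of "axis i 1"] by (simp only:)
  qed
  show "(A $ i $ j)\<^sup>2 \<le> A $ i $ i * A $ j $ j" if "i \<noteq> j"
  proof (rule quadratic_form_two_minor)
    fix p r :: puiseux
    let ?v = "\<chi> k. if k = i then p else if k = j then r else 0"
    have supp: "(\<Sum>k\<in>UNIV. ?v $ k * f k) = p * f i + r * f j" for f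
    proof -
      have "(\<Sum>k\<in>UNIV. ?v $ k * f k) = (\<Sum>k\<in>{i, j}. ?v $ k * f k)"
        by (rule sum.mono_neutral_right) auto
      then show ?thesis using that by auto
    qed
    have "(\<Sum>k\<in>UNIV. ?v $ k * (\<Sum>l\<in>UNIV. ?v $ l * A $ k $ l)) = A $ i $ i * p\<^sup>2 + 2 * A $ i $ j * p * r + A $ j $ j * r\<^sup>2"
      unfolding supp using sym[of j i] by (simp add: algebra_simps power2_eq_square)
    then show "0 \<le> A $ i $ i * p\<^sup>2 + 2 * A $ i $ j * p * r + A $ j $ j * r\<^sup>2"
      using nested[of ?v] by (simp only:)
  qed
qed

lemma abs_geometric_le_arithmetic:
  fixes a b e :: "'a::linordered_field"
  assumes "0 \<le> a" "0 \<le> b" "e\<^sup>2 \<le> a * b"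
  shows "2 * \<bar>e\<bar> \<le> a + b"
proof (rule power2_le_imp_le)
  have "(2 * \<bar>e\<bar>)\<^sup>2 \<le> 4 * (a * b)" using assms(3) by (simp add: power_mult_distrib)
  also have "\<dots> \<le> (a + b)\<^sup>2"
    using zero_le_power2[of "a - b"] by (simp add: algebra_simps power2_eq_square)
  finally show "(2 * \<bar>e\<bar>)\<^sup>2 \<le> (a + b)\<^sup>2" .
qed (use assms in simp)

text \<open>
  This is diagonal dominance after rescaling: with \<open>w\<^sub>i = A\<^sub>i\<^sub>i v\<^sub>i\<^sup>2\<close>, each off-diagonal
  term \<open>v\<^sub>i A\<^sub>i\<^sub>j v\<^sub>j\<close> is at least \<open>-(w\<^sub>i + w\<^sub>j) / (2 m)\<close> by the inequality of the means, and these bounds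
  summed over all \<open>m\<^sup>2\<close> pairs use up exactly \<open>\<Sum>\<^sub>i w\<^sub>i\<close>.
\<close>

lemma psd_if_strong_minors:
  fixes A :: "puiseux ^ 'm ^ 'm"
  assumes "transpose A = A" and diag: "\<And>i. 0 \<le> A $ i $ i"
    and minors: "\<And>i j. i \<noteq> j \<Longrightarrow> (of_nat CARD('m) * A $ i $ j)\<^sup>2 \<le> A $ i $ i * A $ j $ j"
  shows "psd A"
  unfolding psd_def
proof (intro conjI allI)
  fix v :: "puiseux ^ 'm"
  define w where "w i = A $ i $ i * (v $ i)\<^sup>2" for i
  let ?m = "of_nat CARD('m) :: puiseux"
  have m: "0 < ?m" by simp
  have w: "0 \<le> w i" for i using diag by (simp add: w_def)
  have bound: "(if i = j then w i else 0) - (w i + w j) / (2 * ?m) \<le> v $ i * A $ i $ j * v $ j"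
    for i j
  proof (cases "i = j")
    case True
    then show ?thesis using w[of i] m by (simp add: w_def power2_eq_square ac_simps)
  next
    case False
    have "(?m * (v $ i * A $ i $ j * v $ j))\<^sup>2 = (?m * A $ i $ j)\<^sup>2 * ((v $ i)\<^sup>2 * (v $ j)\<^sup>2)"
      by (simp add: power_mult_distrib ac_simps)
    also have "\<dots> \<le> A $ i $ i * A $ j $ j * ((v $ i)\<^sup>2 * (v $ j)\<^sup>2)"
      using minors[OF False] by (rule mult_right_mono) simp
    also have "\<dots> = w i * w j" by (simp add: w_def ac_simps)
    finally have "2 * \<bar>?m * (v $ i * A $ i $ j * v $ j)\<bar> \<le> w i + w j"
      using w by (intro abs_geometric_le_arithmetic)
    then have "- (w i + w j) \<le> 2 * ?m * (v $ i * A $ i $ j * v $ j)"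
      using abs_ge_minus_self[of "?m * (v $ i * A $ i $ j * v $ j)"] by linarith
    then show ?thesis using False m by (simp add: field_simps)
  qed
  have "(\<Sum>i\<in>UNIV. \<Sum>j\<in>UNIV. w i + w j) = 2 * ?m * (\<Sum>i\<in>UNIV. w i)"
    by (simp add: sum.distrib sum_distrib_left[symmetric])
  then have "0 = (\<Sum>i\<in>UNIV. w i) - (\<Sum>i\<in>UNIV. \<Sum>j\<in>UNIV. w i + w j) / (2 * ?m)"
    using m by simp
  also have "\<dots> = (\<Sum>i\<in>UNIV. \<Sum>j\<in>UNIV. (if i = j then w i else 0) - (w i + w j) / (2 * ?m))"
    by (simp add: sum_subtractf sum_divide_distrib)
  also have "\<dots> \<le> (\<Sum>i\<in>UNIV. \<Sum>j\<in>UNIV. v $ i * A $ i $ j * v $ j)"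
    by (intro sum_mono bound)
  finally show "0 \<le> (\<Sum>i\<in>UNIV. \<Sum>j\<in>UNIV. v $ i * A $ i $ j * v $ j)" .
qed (fact assms(1))

section \<open>Valuations of points of the spectrahedron\<close>

definition pencil_entry :: "('n \<Rightarrow> puiseux ^ 'm ^ 'm) \<Rightarrow> puiseux ^ 'n \<Rightarrow> 'm \<Rightarrow> 'm \<Rightarrow> puiseux" where
  "pencil_entry Q X i j = (\<Sum>k\<in>UNIV. X $ k * Q k $ i $ j)"

lemma sval_pos_iff [simp]: "sval x \<in> range TPos \<longleftrightarrow> 0 < x"
  by (auto simp: sval_def)

lemma sval_neg_iff [simp]: "sval x \<in> range TNeg \<longleftrightarrow> x < 0"
  by (auto simp: sval_def)

lemma Qplus_sval:
  "Qplus (\<lambda>k. sval_matrix (Q k)) i j x = (SUP k\<in>{k. 0 < Q k $ i $ j}. val (Q k $ i $ j) + x $ k)"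
  by (simp add: Qplus_def sval_matrix_def modulus_sval)

lemma Qminus_sval:
  "Qminus (\<lambda>k. sval_matrix (Q k)) i j x = (SUP k\<in>{k. Q k $ i $ j < 0}. val (Q k $ i $ j) + x $ k)"
  by (simp add: Qminus_def sval_matrix_def modulus_sval)

text \<open>
  The tropical functions \<open>Q\<^sup>+\<^sub>i\<^sub>j\<close> and \<open>Q\<^sup>-\<^sub>i\<^sub>j\<close> record the valuations of the two parts of an entry in which
  all terms have the same sign, so that nothing cancels within a part.
\<close>

lemma pencil_entry_split:
  fixes X :: "puiseux ^ 'n::finite"
  assumes "\<And>k. 0 \<le> X $ k"
  obtains P N where "0 \<le> P" "0 \<le> N" "pencil_entry Q X i j = P - N"
    "val P = Qplus (\<lambda>k. sval_matrix (Q k)) i j (\<chi> k. val (X $ k))"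
    "val N = Qminus (\<lambda>k. sval_matrix (Q k)) i j (\<chi> k. val (X $ k))"
proof -
  define P where "P = (\<Sum>k\<in>{k. 0 < Q k $ i $ j}. X $ k * Q k $ i $ j)"
  define N where "N = (\<Sum>k\<in>{k. Q k $ i $ j < 0}. X $ k * - Q k $ i $ j)"
  show thesis
  proof
    show "0 \<le> P" "0 \<le> N"
      unfolding P_def N_def using assms
      by (auto intro!: sum_nonneg mult_nonneg_nonneg simp: less_imp_le mult_nonneg_nonpos)
    have "pencil_entry Q X i j = (\<Sum>k\<in>{k. 0 < Q k $ i $ j} \<union> {k. Q k $ i $ j < 0}. X $ k * Q k $ i $ j)"
      unfolding pencil_entry_def by (rule sum.mono_neutral_right) auto
    also have "\<dots> = P - N"
      unfolding P_def N_def by (subst sum.union_disjoint) (auto simp: sum_negf)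
    finally show "pencil_entry Q X i j = P - N" .
    show "val P = Qplus (\<lambda>k. sval_matrix (Q k)) i j (\<chi> k. val (X $ k))"
      unfolding P_def Qplus_sval using assms
      by (subst val_sum_nonneg) (auto simp: val_mult add.commute)
    show "val N = Qminus (\<lambda>k. sval_matrix (Q k)) i j (\<chi> k. val (X $ k))"
      unfolding N_def Qminus_sval using assms
      by (subst val_sum_nonneg) (auto simp: val_mult add.commute mult_nonneg_nonpos)
  qed
qed

lemma ereal_two_mult: "ereal 2 * x = x + (x :: ereal)"
  by (cases x) auto

lemma val_spectrahedron_subset:
  fixes Q :: "'n::finite \<Rightarrow> puiseux ^ 'm::{finite,linorder} ^ 'm::{finite,linorder}"
  assumes "X \<in> spectrahedron Q"
  shows "(\<chi> k. val (X $ k)) \<in> trop_spectrahedron (\<lambda>k. sval_matrix (Q k))"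
proof -
  let ?q = "\<lambda>k. sval_matrix (Q k)" and ?x = "\<chi> k. val (X $ k)"
  let ?A = "\<chi> i j. pencil_entry Q X i j"
  have X: "\<And>k. 0 \<le> X $ k" and A: "psd ?A"
    using assms by (auto simp: spectrahedron_def pencil_entry_def)
  have diag: "Qminus ?q i i ?x \<le> Qplus ?q i i ?x" for i
  proof -
    obtain P N where PN: "0 \<le> P" "0 \<le> N" "pencil_entry Q X i i = P - N"
      "val P = Qplus ?q i i ?x" "val N = Qminus ?q i i ?x"
      using pencil_entry_split[OF X, where Q = Q] by blast
    then have "val N \<le> val P" using psd_minors(1)[OF A, of i] by (intro val_mono) auto
    then show ?thesis using PN by simp
  qed
  have val_diag: "val (pencil_entry Q X i i) \<le> Qplus ?q i i ?x" for i
  proof -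
    obtain P N where PN: "0 \<le> P" "0 \<le> N" "pencil_entry Q X i i = P - N" "val P = Qplus ?q i i ?x"
      using pencil_entry_split[OF X, where Q = Q] by blast
    then have "val (pencil_entry Q X i i) \<le> val P"
      using psd_minors(1)[OF A, of i] by (intro val_mono) auto
    then show ?thesis using PN by simp
  qed
  have off: "2 * max (Qplus ?q i j ?x) (Qminus ?q i j ?x) \<le> Qplus ?q i i ?x + Qplus ?q j j ?x"
    if "i < j" "Qplus ?q i j ?x \<noteq> Qminus ?q i j ?x" for i j
  proof -
    obtain P N where PN: "0 \<le> P" "0 \<le> N" "pencil_entry Q X i j = P - N"
      "val P = Qplus ?q i j ?x" "val N = Qminus ?q i j ?x"
      using pencil_entry_split[OF X, where Q = Q] by blast
    have "2 * max (Qplus ?q i j ?x) (Qminus ?q i j ?x) = val ((pencil_entry Q X i j)\<^sup>2)"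
      using val_diff_nonneg[OF PN(1,2)] PN(3-5) that(2)
      by (simp add: power2_eq_square val_mult ereal_two_mult)
    also have "\<dots> \<le> val (pencil_entry Q X i i * pencil_entry Q X j j)"
      using psd_minors(2)[OF A, of i j] that(1) by (intro val_mono) auto
    also have "\<dots> \<le> Qplus ?q i i ?x + Qplus ?q j j ?x"
      by (simp add: val_mult add_mono val_diag)
    finally show ?thesis .
  qed
  have "?x \<in> trop_points" by (simp add: trop_points_def val_def)
  then show ?thesis using diag off unfolding trop_spectrahedron_def by blast
qed


section \<open>Convexity and sign patterns\<close>

text \<open>
  Coefficients of convex combinations range over the ordered field itself: the coefficients that
  make a form vanish are quotients of series, not real numbers.
\<close>

definition field_convex :: "('a::linordered_field ^ 'n) set \<Rightarrow> bool" where
  "field_convex C \<longleftrightarrow>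
     (\<forall>X\<in>C. \<forall>Y\<in>C. \<forall>a b. 0 \<le> a \<longrightarrow> 0 \<le> b \<longrightarrow> a + b = 1 \<longrightarrow> a *s X + b *s Y \<in> C)"

lemma field_convexD:
  "field_convex C \<Longrightarrow> X \<in> C \<Longrightarrow> Y \<in> C \<Longrightarrow> 0 \<le> a \<Longrightarrow> 0 \<le> b \<Longrightarrow> a + b = 1 \<Longrightarrow> a *s X + b *s Y \<in> C"
  by (simp add: field_convex_def)

lemma field_convex_Int: "field_convex C \<Longrightarrow> field_convex D \<Longrightarrow> field_convex (C \<inter> D)"
  by (simp add: field_convex_def)

lemma field_convex_INT: "(\<And>t. t \<in> T \<Longrightarrow> field_convex (C t)) \<Longrightarrow> field_convex (\<Inter>t\<in>T. C t)"
  by (simp add: field_convex_def)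

text \<open>
  Induction on the number of forms. Restricting the set to either side of the hyperplane
  \<open>L p = 0\<close> keeps it convex and keeps all sign patterns of the other forms. So each side contains a common
  zero of the other forms, and the segment between these two zeros meets the hyperplane.
\<close>

lemma common_zero_of_sign_patterns:
  fixes C :: "('a::linordered_field ^ 'n) set" and L :: "'p \<Rightarrow> 'a ^ 'n \<Rightarrow> 'a"
  assumes "finite F" "field_convex C"
    and "\<And>p a b X Y. p \<in> F \<Longrightarrow> L p (a *s X + b *s Y) = a * L p X + b * L p Y"
    and "\<And>D. D \<subseteq> F \<Longrightarrow> \<exists>X\<in>C. (\<forall>p\<in>D. 0 \<le> L p X) \<and> (\<forall>p\<in>F - D. L p X \<le> 0)"
  shows "\<exists>X\<in>C. \<forall>p\<in>F. L p X = 0"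
  using assms
proof (induction F arbitrary: C)
  case empty
  then show ?case by blast
next
  case (insert p F)
  have lin: "L p' (a *s X + b *s Y) = a * L p' X + b * L p' Y" if "p' \<in> insert p F" for p' a b X Y
    using insert.prems(2) that by blast
  have "\<exists>X\<in>C \<inter> {X. 0 \<le> L p X}. \<forall>p'\<in>F. L p' X = 0"
  proof (rule insert.IH)
    show "field_convex (C \<inter> {X. 0 \<le> L p X})"
      by (rule field_convex_Int[OF insert.prems(1)]) (simp add: field_convex_def lin)
    show "\<exists>X\<in>C \<inter> {X. 0 \<le> L p X}. (\<forall>p\<in>D. 0 \<le> L p X) \<and> (\<forall>p\<in>F - D. L p X \<le> 0)" if D: "D \<subseteq> F" for D
    proof -
      obtain X where "X \<in> C" "\<forall>q\<in>insert p D. 0 \<le> L q X" "\<forall>q\<in>insert p F - insert p D. L q X \<le> 0"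
        using insert.prems(3)[of "insert p D"] insert_mono[OF D] by metis
      moreover have "F - D \<subseteq> insert p F - insert p D" using insert.hyps(2) by auto
      ultimately show ?thesis by (intro bexI[of _ X]) auto
    qed
  qed (rule lin, simp)
  then obtain X where X: "X \<in> C" "0 \<le> L p X" "\<forall>p'\<in>F. L p' X = 0" by blast
  have "\<exists>Y\<in>C \<inter> {Y. L p Y \<le> 0}. \<forall>p'\<in>F. L p' Y = 0"
  proof (rule insert.IH)
    show "field_convex (C \<inter> {Y. L p Y \<le> 0})"
      by (rule field_convex_Int[OF insert.prems(1)])
        (auto simp: field_convex_def lin mult_nonneg_nonpos intro!: add_nonpos_nonpos)
    show "\<exists>Y\<in>C \<inter> {Y. L p Y \<le> 0}. (\<forall>p\<in>D. 0 \<le> L p Y) \<and> (\<forall>p\<in>F - D. L p Y \<le> 0)" if D: "D \<subseteq> F" for D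
    proof -
      obtain Y where "Y \<in> C" "\<forall>q\<in>D. 0 \<le> L q Y" "\<forall>q\<in>insert p F - D. L q Y \<le> 0"
        using insert.prems(3)[of D] subset_insertI2[OF D] by metis
      moreover have "p \<notin> D" using D insert.hyps(2) by auto
      ultimately show ?thesis by (intro bexI[of _ Y]) auto
    qed
  qed (rule lin, simp)
  then obtain Y where Y: "Y \<in> C" "L p Y \<le> 0" "\<forall>p'\<in>F. L p' Y = 0" by blast
  show ?case
  proof (cases "L p X = 0")
    case True
    then show ?thesis using X by blast
  next
    case False
    define d where "d = L p X - L p Y"
    have d: "0 < d" using X(2) Y(2) False unfolding d_def by simp
    define a b where "a = - L p Y / d" and "b = L p X / d"
    have ab: "0 \<le> a" "0 \<le> b" using d X(2) Y(2) by (auto simp: a_def b_def divide_nonpos_pos)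
    have "a + b = (L p X - L p Y) / d" by (simp add: a_def b_def diff_divide_distrib)
    then have "a + b = 1" using d by (simp add: d_def)
    then have "a *s X + b *s Y \<in> C" using field_convexD[OF insert.prems(1) X(1) Y(1) ab] by simp
    moreover have "L p (a *s X + b *s Y) = a * L p X + b * L p Y" by (rule lin) simp
    then have "L p (a *s X + b *s Y) = 0" by (simp add: a_def b_def)
    moreover have "\<forall>p'\<in>F. L p' (a *s X + b *s Y) = 0" using X(3) Y(3) by (simp add: lin)
    ultimately show ?thesis by (metis insert_iff)
  qed
qed

text \<open>
  The cone \<open>e\<^sup>2 \<le> a b\<close>, \<open>a, b \<ge> 0\<close> is closed under addition, because the mixed terms satisfy
  \<open>2 \<bar>e e'\<bar> \<le> a b' + a' b\<close>. This makes the set of points satisfying a strong minor inequality convex.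
\<close>

lemma geometric_mean_superadditive:
  fixes a b e a' b' e' :: "'a::linordered_field"
  assumes "0 \<le> a" "0 \<le> b" "e\<^sup>2 \<le> a * b" and "0 \<le> a'" "0 \<le> b'" "e'\<^sup>2 \<le> a' * b'"
  shows "(e + e')\<^sup>2 \<le> (a + a') * (b + b')"
proof -
  have "(e * e')\<^sup>2 \<le> (a * b) * (a' * b')"
    unfolding power_mult_distrib using assms by (intro mult_mono) auto
  then have "2 * \<bar>e * e'\<bar> \<le> a * b' + a' * b"
    using assms by (intro abs_geometric_le_arithmetic) (auto simp: ac_simps)
  then have "2 * (e * e') \<le> a * b' + a' * b" using abs_ge_self[of "e * e'"] by linarith
  then show ?thesis using assms(3,6) by (simp add: algebra_simps power2_eq_square)
qed

lemma pencil_entry_linear: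
  "pencil_entry Q (a *s X + b *s Y) i j = a * pencil_entry Q X i j + b * pencil_entry Q Y i j"
  by (simp add: pencil_entry_def sum_distrib_left sum.distrib algebra_simps)

lemma field_convex_diagonal: "field_convex {X. 0 \<le> pencil_entry Q X i i}"
  by (simp add: field_convex_def pencil_entry_linear)

lemma field_convex_minor:
  "field_convex {X. 0 \<le> pencil_entry Q X i i \<and> 0 \<le> pencil_entry Q X j j \<and>
     (c * pencil_entry Q X i j)\<^sup>2 \<le> pencil_entry Q X i i * pencil_entry Q X j j}"
  unfolding field_convex_def mem_Collect_eq pencil_entry_linear
proof (intro ballI allI impI, elim CollectE conjE, intro conjI)
  fix X Y and a b :: puiseux
  assume ab: "0 \<le> a" "0 \<le> b" "a + b = 1"
  assume X: "0 \<le> pencil_entry Q X i i" "0 \<le> pencil_entry Q X j j"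
    "(c * pencil_entry Q X i j)\<^sup>2 \<le> pencil_entry Q X i i * pencil_entry Q X j j"
  assume Y: "0 \<le> pencil_entry Q Y i i" "0 \<le> pencil_entry Q Y j j"
    "(c * pencil_entry Q Y i j)\<^sup>2 \<le> pencil_entry Q Y i i * pencil_entry Q Y j j"
  have scale: "(t * e)\<^sup>2 \<le> (t * p) * (t * r)" if "e\<^sup>2 \<le> p * r" for t e p r :: puiseux
  proof -
    have "t\<^sup>2 * e\<^sup>2 \<le> t\<^sup>2 * (p * r)" using that by (intro mult_left_mono) auto
    then show ?thesis by (simp add: power2_eq_square ac_simps)
  qed
  show "0 \<le> a * pencil_entry Q X i i + b * pencil_entry Q Y i i"
    "0 \<le> a * pencil_entry Q X j j + b * pencil_entry Q Y j j"
    using ab X Y by auto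
  have "(a * (c * pencil_entry Q X i j) + b * (c * pencil_entry Q Y i j))\<^sup>2
      \<le> (a * pencil_entry Q X i i + b * pencil_entry Q Y i i)
        * (a * pencil_entry Q X j j + b * pencil_entry Q Y j j)"
    using ab X Y by (intro geometric_mean_superadditive scale) auto
  then show "(c * (a * pencil_entry Q X i j + b * pencil_entry Q Y i j))\<^sup>2
      \<le> (a * pencil_entry Q X i i + b * pencil_entry Q Y i i)
        * (a * pencil_entry Q X j j + b * pencil_entry Q Y j j)"
    by (simp add: algebra_simps)
qed

text \<open>
  A convex combination of two nonnegative series lies between their minimum and their maximum,
  and the valuation is monotone on nonnegative series.
\<close>

lemma field_convex_val: "field_convex {X :: puiseux ^ 'n. 0 \<le> X $ k \<and> val (X $ k) = x}"
  unfolding field_convex_def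
proof (intro ballI allI impI CollectI, elim CollectE conjE, intro conjI)
  fix X Y :: "puiseux ^ 'n" and a b :: puiseux
  assume ab: "0 \<le> a" "0 \<le> b" "a + b = 1" and X: "0 \<le> X $ k" "val (X $ k) = x"
    and Y: "0 \<le> Y $ k" "val (Y $ k) = x"
  show "0 \<le> (a *s X + b *s Y) $ k" using ab X Y by simp
  have "min (X $ k) (Y $ k) = (a + b) * min (X $ k) (Y $ k)" using ab by simp
  also have "\<dots> \<le> (a *s X + b *s Y) $ k"
    unfolding distrib_right using ab by (auto intro!: add_mono mult_left_mono)
  finally have lower: "min (X $ k) (Y $ k) \<le> (a *s X + b *s Y) $ k" .
  have "(a *s X + b *s Y) $ k \<le> (a + b) * max (X $ k) (Y $ k)"
    unfolding distrib_right using ab by (auto intro!: add_mono mult_left_mono)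
  then have upper: "(a *s X + b *s Y) $ k \<le> max (X $ k) (Y $ k)" using ab by simp
  have "val (min (X $ k) (Y $ k)) = x" "val (max (X $ k) (Y $ k)) = x"
    using X Y by (auto simp: min_def max_def)
  then show "val ((a *s X + b *s Y) $ k) = x"
    using val_mono[OF _ lower] val_mono[OF _ upper] \<open>0 \<le> (a *s X + b *s Y) $ k\<close> X Y
    by (auto intro!: antisym)
qed

section \<open>Generic points of regular sets\<close>

text \<open>
  The exponential \<open>3\<^sup>n\<close> has no nontrivial three-term progression. It provides a
  direction that is not parallel to any of the hyperplanes \<open>y\<^sub>k + y\<^sub>l - 2 y\<^sub>p = c\<close>.
\<close>

lemma power_three_midpoint:
  fixes a b c :: nat
  assumes "(3::real) ^ a + 3 ^ b = 2 * 3 ^ c"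
  shows "a = c \<and> b = c"
proof -
  have *: "a = b" if "(3::real) ^ a + 3 ^ b = 2 * 3 ^ c" "a \<le> b" for a b :: nat
  proof (rule ccontr)
    assume "a \<noteq> b"
    then have "(3::real) ^ a < 3 ^ b" using that(2) by simp
    then have lt: "(3::real) ^ c < 3 ^ b" using that(1) by linarith
    then have "Suc c \<le> b" by (simp add: Suc_le_eq)
    then have "(3::real) ^ Suc c \<le> 3 ^ b" by (intro power_increasing) auto
    moreover have "0 < (3::real) ^ a" "0 < (3::real) ^ c" by simp_all
    ultimately show False using that(1) unfolding power_Suc by linarith
  qed
  have "a = b"
    using *[of a b] *[of b a] assms by (cases "a \<le> b") (auto simp: add.commute)
  then show ?thesis using assms by simp
qed

text \<open>
  Moving from a point of \<open>W\<close> in the direction \<open>(3\<^bsup>e(k)\<^esup>)\<^sub>k\<close>, each of the finitely many hyperplanes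
  is crossed at most once, while an interval of parameters stays in \<open>W\<close>.
\<close>

lemma generic_point_in_open:
  fixes W :: "('n::finite \<Rightarrow> real) set"
  assumes W: "openin (powertop_real K) W" "W \<noteq> {}" and "finite C"
  shows "\<exists>y\<in>W. \<forall>k\<in>K. \<forall>l\<in>K. \<forall>p\<in>K. \<not> (k = l \<and> l = p) \<longrightarrow> y k + y l - 2 * y p \<notin> C"
proof -
  obtain z where z: "z \<in> W" using W(2) by blast
  have ext: "z \<in> extensional K" using openin_subset[OF W(1)] z by (auto simp: PiE_def)
  obtain e :: "'n \<Rightarrow> nat" where e: "inj e"
    using finite_imp_inj_to_nat_seg[of "UNIV :: 'n set"] by auto
  define v where "v k = (3::real) ^ e k" for k
  define \<gamma> where "\<gamma> t = (\<lambda>k\<in>K. z k + t * v k)" for t :: real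
  have "continuous_map euclideanreal (powertop_real K) \<gamma>"
    unfolding continuous_map_componentwise
  proof (intro conjI ballI)
    show "\<gamma> ` topspace euclideanreal \<subseteq> extensional K" by (auto simp: \<gamma>_def)
    fix k assume "k \<in> K"
    then have "(\<lambda>t. \<gamma> t k) = (\<lambda>t. z k + t * v k)" by (simp add: \<gamma>_def)
    then show "continuous_map euclideanreal euclideanreal (\<lambda>t. \<gamma> t k)"
      by (simp add: continuous_intros)
  qed
  then have "openin euclideanreal {t \<in> topspace euclideanreal. \<gamma> t \<in> W}"
    using W(1) by (rule openin_continuous_map_preimage)
  then have "open {t. \<gamma> t \<in> W}" by simp
  moreover have "\<gamma> 0 = z" unfolding \<gamma>_def using ext by (auto simp: extensional_def)
  ultimately have inf: "infinite {t. \<gamma> t \<in> W}"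
    using z finite_imp_not_open[of "{t. \<gamma> t \<in> W}"] by blast
  define bad where "bad = (\<lambda>(k, l, p, c). (c - (z k + z l - 2 * z p)) / (v k + v l - 2 * v p))
      ` (UNIV \<times> UNIV \<times> UNIV \<times> C)"
  have "finite bad" unfolding bad_def using \<open>finite C\<close> by simp
  then have "\<not> {t. \<gamma> t \<in> W} \<subseteq> bad" using inf finite_subset by metis
  then obtain t where t: "\<gamma> t \<in> W" "t \<notin> bad" by auto
  show ?thesis
  proof (intro bexI[OF _ t(1)] ballI impI notI)
    fix k l p assume K: "k \<in> K" "l \<in> K" "p \<in> K" and ne: "\<not> (k = l \<and> l = p)"
      and C: "\<gamma> t k + \<gamma> t l - 2 * \<gamma> t p \<in> C"
    have w: "v k + v l - 2 * v p \<noteq> 0"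
      using power_three_midpoint[of "e k" "e l" "e p"] ne e by (auto simp: v_def inj_def)
    have "\<gamma> t k + \<gamma> t l - 2 * \<gamma> t p = z k + z l - 2 * z p + t * (v k + v l - 2 * v p)"
      using K by (simp add: \<gamma>_def algebra_simps)
    then have "t = (\<gamma> t k + \<gamma> t l - 2 * \<gamma> t p - (z k + z l - 2 * z p)) / (v k + v l - 2 * v p)"
      using w by simp
    moreover have "(k, l, p, \<gamma> t k + \<gamma> t l - 2 * \<gamma> t p) \<in> UNIV \<times> UNIV \<times> UNIV \<times> C" using C by simp
    ultimately have "t \<in> bad" unfolding bad_def by (metis (mono_tags, lifting) case_prod_conv image_eqI)
    then show False using t(2) by simp
  qed
qed

text \<open>
  All tropical comparisons that matter are of the form \<open>y\<^sub>k + y\<^sub>l - 2 y\<^sub>p < c\<close> for finitely many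
  constants \<open>c\<close>; comparisons of two terms are the case \<open>k = l\<close>. The strict ones at \<open>x\<close> define an
  open neighbourhood of \<open>x\<close>, which meets the interior of \<open>S\<close>.
\<close>

lemma generic_point_near:
  fixes S :: "('n::finite \<Rightarrow> real) set"
  assumes reg: "regular_in (powertop_real K) S" and x: "x \<in> S" and C: "finite C"
  obtains y where "y \<in> S"
    and "\<And>k l p c. \<lbrakk>k \<in> K; l \<in> K; p \<in> K; c \<in> C; \<not> (k = l \<and> l = p)\<rbrakk> \<Longrightarrow> y k + y l - 2 * y p \<noteq> c"
    and "\<And>k l p c. \<lbrakk>k \<in> K; l \<in> K; p \<in> K; c \<in> C; x k + x l - 2 * x p < c\<rbrakk> \<Longrightarrow> y k + y l - 2 * y p < c"
proof -
  let ?X = "powertop_real K"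
  define T where "T = {(k, l, p, c). k \<in> K \<and> l \<in> K \<and> p \<in> K \<and> c \<in> C \<and> x k + x l - 2 * x p < c}"
  have "finite (UNIV \<times> UNIV \<times> UNIV \<times> C :: ('n \<times> 'n \<times> 'n \<times> real) set)" using C by simp
  then have finT: "finite T" by (rule rev_finite_subset) (auto simp: T_def)
  define U where "U = topspace ?X \<inter> (\<Inter>(k, l, p, c)\<in>T. {y \<in> topspace ?X. y k + y l - 2 * y p \<in> {..<c}})"
  have "openin ?X U"
    unfolding U_def
  proof (cases "T = {}")
    case False
    have "openin ?X (\<Inter>(k, l, p, c)\<in>T. {y \<in> topspace ?X. y k + y l - 2 * y p \<in> {..<c}})"
    proof (rule openin_INT2[OF finT False], clarify)
      fix k l p c assume "(k, l, p, c) \<in> T"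
      then have K: "k \<in> K" "l \<in> K" "p \<in> K" by (auto simp: T_def)
      have "continuous_map ?X euclideanreal (\<lambda>y. y k + y l - 2 * y p)"
        by (intro continuous_map_add continuous_map_diff continuous_map_real_mult_left
            continuous_map_product_projection K)
      then show "openin ?X {y \<in> topspace ?X. y k + y l - 2 * y p \<in> {..<c}}"
        by (rule openin_continuous_map_preimage) simp
    qed
    then show "openin ?X (topspace ?X \<inter> (\<Inter>(k, l, p, c)\<in>T. {y \<in> topspace ?X. y k + y l - 2 * y p \<in> {..<c}}))"
      by (rule openin_Int[OF openin_topspace])
  next
    case True
    then show "openin ?X (topspace ?X \<inter> (\<Inter>(k, l, p, c)\<in>T. {y \<in> topspace ?X. y k + y l - 2 * y p \<in> {..<c}}))"
      using openin_topspace[of ?X] by simp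
  qed
  have cl: "x \<in> ?X closure_of (?X interior_of S)" using reg x by (simp add: regular_in_def)
  then have "x \<in> topspace ?X" by (meson closure_of_subset_topspace subsetD)
  then have "x \<in> U" by (auto simp: U_def T_def)
  then have "U \<inter> ?X interior_of S \<noteq> {}"
    using cl \<open>openin ?X U\<close> unfolding in_closure_of by blast
  moreover have "openin ?X (U \<inter> ?X interior_of S)" using \<open>openin ?X U\<close> by (intro openin_Int openin_interior_of)
  ultimately obtain y where y: "y \<in> U \<inter> ?X interior_of S"
    and gen: "\<forall>k\<in>K. \<forall>l\<in>K. \<forall>p\<in>K. \<not> (k = l \<and> l = p) \<longrightarrow> y k + y l - 2 * y p \<notin> C"
    using generic_point_in_open[OF _ _ C] by metis
  show thesis
  proof
    show "y \<in> S" using y interior_of_subset[of ?X S] by auto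
    show "y k + y l - 2 * y p \<noteq> c"
      if "k \<in> K" "l \<in> K" "p \<in> K" "c \<in> C" "\<not> (k = l \<and> l = p)" for k l p c
      using gen that by metis
    show "y k + y l - 2 * y p < c"
      if "k \<in> K" "l \<in> K" "p \<in> K" "c \<in> C" "x k + x l - 2 * x p < c" for k l p c
    proof -
      have "(k, l, p, c) \<in> T" using that by (simp add: T_def)
      then show ?thesis using y unfolding U_def by fastforce
    qed
  qed
qed


section \<open>Lifting generic tropical points\<close>

text \<open>
  Inequalities between monomials \<open>s\<^sup>d t\<^sup>\<kappa>\<close> for large real \<open>s\<close> are decided
  lexicographically, first by the exponent of \<open>t\<close> and then by the exponent of \<open>s\<close>. The
  hypotheses on \<open>\<kappa>, \<mu>, d, e\<close> put the second monomial above the first in this order: if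
  \<open>\<kappa> = \<mu>\<close> then \<open>d < e\<close>. They are stated for the sums \<open>\<kappa> + d\<close> and \<open>\<mu> + e\<close> because these become the
  values of tropical terms at the perturbed point.
\<close>

lemma eventually_scaled_le:
  fixes f g :: "real \<Rightarrow> puiseux"
  assumes f: "\<And>s. 0 < s \<Longrightarrow> lead_exp (f s) = \<kappa> \<and> lc (f s) = a * s powr d" and a: "0 < a"
    and g: "\<And>s. 0 < s \<Longrightarrow> lead_exp (g s) = \<mu> \<and> lc (g s) = b * s powr e" and b: "0 < b"
    and le: "\<kappa> \<le> \<mu>" and less: "\<kappa> + d < \<mu> + e" and M: "0 < M"
  shows "\<forall>\<^sub>F s in at_top. of_nat M * f s \<le> g s"
proof -
  have ev: "\<forall>\<^sub>F s in at_top. \<kappa> = \<mu> \<longrightarrow> real M * a * s powr (d - e) < b"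
  proof (cases "\<kappa> = \<mu>")
    case True
    have "((\<lambda>s. real M * a * s powr (d - e)) \<longlongrightarrow> real M * a * 0) at_top"
      using True less by (intro tendsto_mult tendsto_const tendsto_neg_powr filterlim_ident) auto
    then have "\<forall>\<^sub>F s in at_top. real M * a * s powr (d - e) < b"
      using b by (intro order_tendstoD(2)) auto
    then show ?thesis by (rule eventually_mono) simp
  qed simp
  show ?thesis
    using ev eventually_gt_at_top[of "0::real"]
  proof eventually_elim
    case (elim s)
    have fs: "f s \<noteq> 0" and gs: "0 < g s"
      using f[OF elim(2)] g[OF elim(2)] a b elim(2) by (auto simp: puiseux_pos_iff)
    \<comment> \<open>The factor \<open>M\<close> has valuation \<open>0\<close>, so it only matters when \<open>\<kappa> = \<mu>\<close>.\<close>
    have lead: "lead_exp (of_nat M * f s) = \<kappa>"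
      using M fs f[OF elim(2)] by (simp add: lead_exp_mult lead_exp_of_nat)
    have "lc (of_nat M * f s) < lc (g s)" if "\<kappa> = \<mu>"
    proof -
      have "real M * a * s powr (d - e) * s powr e < b * s powr e"
        using elim that by (intro mult_strict_right_mono) auto
      then have "real M * a * s powr d < b * s powr e"
        by (simp add: mult.assoc flip: powr_add)
      then show ?thesis
        using f[OF elim(2)] g[OF elim(2)] by (simp add: lc_mult lc_of_nat mult.assoc)
    qed
    then have "of_nat M * f s < g s"
      using le lead g[OF elim(2)] by (intro puiseux_less_lex[OF gs]) (metis order_le_less)
    then show ?case by (rule less_imp_le)
  qed
qed

text \<open>
  The contribution of a coefficient \<open>a\<close> and a variable lifted to \<open>s\<^bsup>y - x\<^esup> t\<^sup>x\<close>.
\<close>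

definition scaled_term :: "real \<Rightarrow> real \<Rightarrow> puiseux \<Rightarrow> real \<Rightarrow> puiseux" where
  "scaled_term x y a s = puiseux_monom (s powr (y - x)) x * a"

lemma scaled_term:
  assumes "0 < s" "a \<noteq> 0"
  shows "lead_exp (scaled_term x y a s) = x + lead_exp a"
    and "lc (scaled_term x y a s) = s powr (y - x) * lc a"
    and "scaled_term x y a s \<noteq> 0"
  using assms by (simp_all add: scaled_term_def lead_exp_mult lc_mult lead_exp_monom lc_monom)

lemma eventually_dominated:
  assumes nz: "a \<noteq> 0" "b \<noteq> 0" "c \<noteq> 0" and M: "0 < M"
    and le: "2 * (lead_exp a + xa) \<le> lead_exp b + xb + (lead_exp c + xc)"
    and less: "2 * (lead_exp a + ya) < lead_exp b + yb + (lead_exp c + yc)"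
  shows "\<forall>\<^sub>F s in at_top. of_nat M * (scaled_term xa ya a s)\<^sup>2
    \<le> \<bar>scaled_term xb yb b s * scaled_term xc yc c s\<bar>"
proof (rule eventually_scaled_le[OF _ _ _ _ _ _ M])
  fix s :: real assume s: "0 < s"
  show "lead_exp ((scaled_term xa ya a s)\<^sup>2) = 2 * (lead_exp a + xa) \<and>
      lc ((scaled_term xa ya a s)\<^sup>2) = (lc a)\<^sup>2 * s powr (2 * (ya - xa))"
    using s nz by (simp add: power2_eq_square lead_exp_mult lc_mult scaled_term powr_add[symmetric])
  show "lead_exp \<bar>scaled_term xb yb b s * scaled_term xc yc c s\<bar> = lead_exp b + xb + (lead_exp c + xc) \<and>
      lc \<bar>scaled_term xb yb b s * scaled_term xc yc c s\<bar>
      = \<bar>lc b * lc c\<bar> * s powr (yb - xb + (yc - xc))"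
    using s nz by (simp add: lead_exp_mult lc_mult scaled_term powr_add abs_mult)
next
  show "0 < (lc a)\<^sup>2" "0 < \<bar>lc b * lc c\<bar>" using nz by simp_all
  show "2 * (lead_exp a + xa) + 2 * (ya - xa) < lead_exp b + xb + (lead_exp c + xc) + (yb - xb + (yc - xc))"
    using less by (simp add: algebra_simps)
qed (rule le)

lemma dominant_term:
  fixes T :: "'k \<Rightarrow> 'a::linordered_field"
  assumes S: "finite S" "k0 \<in> S" "card S \<le> n"
    and dom: "\<And>k. k \<in> S \<Longrightarrow> k \<noteq> k0 \<Longrightarrow> (2 * of_nat n * T k)\<^sup>2 \<le> (T k0)\<^sup>2"
  shows "2 * \<bar>(\<Sum>k\<in>S. T k) - T k0\<bar> \<le> \<bar>T k0\<bar>"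
proof -
  have n: "0 < n" using S by (metis card_gt_0_iff empty_iff not_gr0 le_zero_eq)
  have small: "2 * of_nat n * \<bar>T k\<bar> \<le> \<bar>T k0\<bar>" if "k \<in> S - {k0}" for k
    using dom[of k] that by (simp add: abs_le_square_iff[symmetric] abs_mult)
  have "(\<Sum>k\<in>S. T k) - T k0 = (\<Sum>k\<in>S - {k0}. T k)" using S by (simp add: sum_diff1)
  then have "of_nat n * (2 * \<bar>(\<Sum>k\<in>S. T k) - T k0\<bar>) \<le> of_nat n * (2 * (\<Sum>k\<in>S - {k0}. \<bar>T k\<bar>))"
    using sum_abs[of T "S - {k0}"] by (intro mult_left_mono) auto
  also have "\<dots> = (\<Sum>k\<in>S - {k0}. 2 * of_nat n * \<bar>T k\<bar>)" by (simp add: sum_distrib_left ac_simps)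
  also have "\<dots> \<le> of_nat (card (S - {k0})) * \<bar>T k0\<bar>" using small by (rule sum_bounded_above)
  also have "\<dots> \<le> of_nat n * \<bar>T k0\<bar>"
  proof (rule mult_right_mono)
    have "card (S - {k0}) \<le> card S" by (rule card_Diff1_le)
    then show "of_nat (card (S - {k0})) \<le> (of_nat n :: 'a)" using S(3) by simp
  qed simp
  finally show ?thesis using n by simp
qed

lemma SUP_less_finite:
  fixes f :: "'k \<Rightarrow> ereal"
  assumes "finite S" "\<And>k. k \<in> S \<Longrightarrow> f k < c" "-\<infinity> < c"
  shows "(SUP k\<in>S. f k) < c"
  using assms by (induction S) (auto simp: sup_max bot_ereal_def)

definition extend_point :: "'n set \<Rightarrow> ('n \<Rightarrow> real) \<Rightarrow> ereal ^ 'n" where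
  "extend_point K y = (\<chi> k. if k \<in> K then ereal (y k) else -\<infinity>)"

definition dominant_at :: "('n \<Rightarrow> puiseux ^ 'm ^ 'm) \<Rightarrow> 'n set \<Rightarrow> ('n \<Rightarrow> real) \<Rightarrow> 'm \<Rightarrow> 'm \<Rightarrow> 'n \<Rightarrow> bool" where
  "dominant_at Q K y i j k \<longleftrightarrow> k \<in> K \<and> Q k $ i $ j \<noteq> 0 \<and>
     (\<forall>l\<in>K. l \<noteq> k \<longrightarrow> Q l $ i $ j \<noteq> 0 \<longrightarrow> lead_exp (Q l $ i $ j) + y l < lead_exp (Q k $ i $ j) + y k)"

lemma ex_dominant_at:
  fixes Q :: "'n::finite \<Rightarrow> puiseux ^ 'm ^ 'm"
  assumes gen: "\<And>k l. k \<in> K \<Longrightarrow> l \<in> K \<Longrightarrow> k \<noteq> l \<Longrightarrow> Q k $ i $ j \<noteq> 0 \<Longrightarrow> Q l $ i $ j \<noteq> 0 \<Longrightarrow>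
      lead_exp (Q k $ i $ j) + y k \<noteq> lead_exp (Q l $ i $ j) + y l"
    and ex: "\<exists>k\<in>K. Q k $ i $ j \<noteq> 0"
  shows "\<exists>k. dominant_at Q K y i j k"
proof -
  let ?S = "{k \<in> K. Q k $ i $ j \<noteq> 0}" and ?E = "\<lambda>k. lead_exp (Q k $ i $ j) + y k"
  have "Max (?E ` ?S) \<in> ?E ` ?S" using ex by (intro Max_in) auto
  then obtain k where k: "k \<in> ?S" "?E k = Max (?E ` ?S)" by auto
  have "?E l < ?E k" if "l \<in> ?S" "l \<noteq> k" for l
  proof -
    have "?E l \<le> ?E k" unfolding k(2) using that by (intro Max_ge) auto
    then show ?thesis using gen[of l k] that k(1) by force
  qed
  then show ?thesis using k(1) unfolding dominant_at_def by blast
qed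

lemma tropical_values_at_dominant:
  fixes Q :: "'n::finite \<Rightarrow> puiseux ^ 'm ^ 'm" and y :: "'n \<Rightarrow> real"
  assumes k: "dominant_at Q K y i j k"
  defines "q \<equiv> \<lambda>k. sval_matrix (Q k)" and "E \<equiv> ereal (lead_exp (Q k $ i $ j) + y k)"
  shows "0 < Q k $ i $ j \<Longrightarrow> Qplus q i j (extend_point K y) = E \<and> Qminus q i j (extend_point K y) < E"
    and "Q k $ i $ j < 0 \<Longrightarrow> Qminus q i j (extend_point K y) = E \<and> Qplus q i j (extend_point K y) < E"
proof -
  define f where "f l = val (Q l $ i $ j) + extend_point K y $ l" for l
  have fk: "f k = E" using k by (simp add: f_def E_def dominant_at_def val_def extend_point_def)
  have fl: "f l < E" if "l \<noteq> k" for l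
    using k that by (auto simp: f_def E_def dominant_at_def val_def extend_point_def)
  have with_k: "(SUP l\<in>S. f l) = E" if "k \<in> S" for S
    using that fl fk by (intro antisym SUP_least) (metis less_imp_le order_refl, metis SUP_upper)
  have without_k: "(SUP l\<in>S. f l) < E" if "k \<notin> S" for S
    using that fl by (intro SUP_less_finite) (simp, metis, simp add: E_def)
  show "0 < Q k $ i $ j \<Longrightarrow> Qplus q i j (extend_point K y) = E \<and> Qminus q i j (extend_point K y) < E"
    unfolding q_def Qplus_sval Qminus_sval f_def[symmetric] by (intro conjI with_k without_k) auto
  show "Q k $ i $ j < 0 \<Longrightarrow> Qminus q i j (extend_point K y) = E \<and> Qplus q i j (extend_point K y) < E"
    unfolding q_def Qplus_sval Qminus_sval f_def[symmetric] by (intro conjI with_k without_k) auto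
qed

lemma Qplus_extend_point_vanishing:
  fixes Q :: "'n::finite \<Rightarrow> puiseux ^ 'm ^ 'm"
  assumes "\<And>k. k \<in> K \<Longrightarrow> Q k $ i $ j = 0"
  shows "Qplus (\<lambda>k. sval_matrix (Q k)) i j (extend_point K y) = -\<infinity>"
proof -
  have "Qplus (\<lambda>k. sval_matrix (Q k)) i j (extend_point K y) \<le> -\<infinity>"
    unfolding Qplus_sval using assms
    by (intro SUP_least) (auto simp: extend_point_def val_def)
  then show ?thesis by simp
qed

text \<open>
  Excludes the ties that no perturbation of the point can break, namely those in which the three
  terms of a tropical minor inequality share the same variable.
\<close>

definition no_diagonal_tie :: "('n \<Rightarrow> puiseux ^ 'm ^ 'm) \<Rightarrow> bool" where
  "no_diagonal_tie Q \<longleftrightarrow> (\<forall>k i j. i \<noteq> j \<longrightarrow> 0 < Q k $ i $ i \<longrightarrow> 0 < Q k $ j $ j \<longrightarrow> Q k $ i $ j \<noteq> 0 \<longrightarrow>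
     lead_exp (Q k $ i $ i) + lead_exp (Q k $ j $ j) \<noteq> 2 * lead_exp (Q k $ i $ j))"

text \<open>
  The constraints of the piece given by \<open>\<Sigma>\<close> and \<open>R\<close>, lifted to the series, with the factor
  \<open>m\<close> in the minors that diagonal dominance requires.
\<close>

definition signed_lift ::
  "('n::finite \<Rightarrow> puiseux ^ 'm::{finite,linorder} ^ 'm::{finite,linorder}) \<Rightarrow> ('m \<times> 'm) set \<Rightarrow>
   ('m \<times> 'm \<Rightarrow> ereal \<Rightarrow> ereal \<Rightarrow> bool) \<Rightarrow> ereal ^ 'n \<Rightarrow> puiseux ^ 'n \<Rightarrow> bool" where
  "signed_lift Q \<Sigma> R x X \<longleftrightarrow>
     (\<forall>k. 0 \<le> X $ k \<and> val (X $ k) = x $ k) \<and>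
     (\<forall>i. 0 \<le> pencil_entry Q X i i) \<and>
     (\<forall>(i, j)\<in>\<Sigma>. (of_nat CARD('m) * pencil_entry Q X i j)\<^sup>2
        \<le> pencil_entry Q X i i * pencil_entry Q X j j) \<and>
     (\<forall>(i, j)\<in>upper_pairs - \<Sigma>. (R (i, j) = (\<ge>) \<longrightarrow> 0 \<le> pencil_entry Q X i j) \<and>
        (R (i, j) = (\<le>) \<longrightarrow> pencil_entry Q X i j \<le> 0))"

text \<open>
  The lift takes \<open>s\<close> so large that every strict inequality at \<open>y\<close>, between a
  squared term and a product of two terms, holds for the series with the
  factor \<open>16 n\<^sup>2\<close>. As \<open>n\<close> bounds the number of terms, each entry then differs
  from its dominant term by at most half of that term, so it inherits the sign.
  In the minors, passing from the entries to their dominant terms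
  loses a factor \<open>4\<close> on each side, and \<open>n \<ge> m\<close> provides the factor \<open>m\<^sup>2\<close>.
\<close>

lemma lift_generic_point:
  fixes Q :: "'n::finite \<Rightarrow> puiseux ^ 'm::{finite,linorder} ^ 'm::{finite,linorder}"
    and x y :: "'n \<Rightarrow> real" and K :: "'n set"
  defines "q \<equiv> \<lambda>k. sval_matrix (Q k)"
    and "E \<equiv> \<lambda>z k i j. lead_exp (Q k $ i $ j) + z k"
  assumes generic_Q: "no_diagonal_tie Q"
    and generic_y: "\<And>k l p i j i' j' r t. \<lbrakk>k \<in> K; l \<in> K; p \<in> K; \<not> (k = l \<and> l = p)\<rbrakk> \<Longrightarrow>
      E y k i j + E y l i' j' \<noteq> 2 * E y p r t"
    and near: "\<And>k l p i j i' j' r t. \<lbrakk>k \<in> K; l \<in> K; p \<in> K; 2 * E y p r t < E y k i j + E y l i' j'\<rbrakk> \<Longrightarrow>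
      2 * E x p r t \<le> E x k i j + E x l i' j'"
    and y: "extend_point K y \<in> trop_piece \<Sigma> R q" and \<Sigma>: "\<Sigma> \<subseteq> upper_pairs"
  shows "\<exists>X. signed_lift Q \<Sigma> R (extend_point K x) X"
proof -
  define n where "n = CARD('n) + CARD('m)"
  define W where "W s e = (case e of (k, i, j) \<Rightarrow> scaled_term (x k) (y k) (Q k $ i $ j) s)" for s e
  \<comment> \<open>An admissible comparison at \<open>y\<close>; terms are indexed by a variable and a matrix position.\<close>
  define H where "H e f g \<longleftrightarrow> (case (e, f, g) of ((p, r, t), (k, i, j), (l, i', j')) \<Rightarrow>
     p \<in> K \<and> k \<in> K \<and> l \<in> K \<and> Q p $ r $ t \<noteq> 0 \<and> Q k $ i $ j \<noteq> 0 \<and> Q l $ i' $ j' \<noteq> 0 \<and>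
     2 * E y p r t < E y k i j + E y l i' j')" for e f g :: "'n \<times> 'm \<times> 'm"
  have n0: "0 < n" by (simp add: n_def)
  have "\<forall>\<^sub>F s in at_top. H e f g \<longrightarrow> of_nat (16 * n\<^sup>2) * (W s e)\<^sup>2 \<le> \<bar>W s f * W s g\<bar>" for e f g
  proof (cases "H e f g")
    case True
    obtain p r t k i j l i' j' where efg: "e = (p, r, t)" "f = (k, i, j)" "g = (l, i', j')"
      by (metis prod_cases3)
    have "\<forall>\<^sub>F s in at_top. of_nat (16 * n\<^sup>2) * (W s e)\<^sup>2 \<le> \<bar>W s f * W s g\<bar>"
      using True near[of k l p r t i j i' j'] n0 unfolding W_def H_def efg E_def prod.case
      by (intro eventually_dominated) auto
    then show ?thesis by (rule eventually_mono) simp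
  qed simp
  then have "\<forall>\<^sub>F s in at_top. \<forall>e f g. H e f g \<longrightarrow> of_nat (16 * n\<^sup>2) * (W s e)\<^sup>2 \<le> \<bar>W s f * W s g\<bar>"
    by (intro eventually_all_finite)
  then have "\<forall>\<^sub>F s in at_top. 0 < s \<and>
      (\<forall>e f g. H e f g \<longrightarrow> of_nat (16 * n\<^sup>2) * (W s e)\<^sup>2 \<le> \<bar>W s f * W s g\<bar>)"
    using eventually_gt_at_top[of "0::real"] by (rule eventually_conj[rotated])
  then have "\<exists>s>0. \<forall>e f g. H e f g \<longrightarrow> of_nat (16 * n\<^sup>2) * (W s e)\<^sup>2 \<le> \<bar>W s f * W s g\<bar>"
    by (rule eventually_happens'[OF trivial_limit_at_top_linorder])
  then obtain s :: real where s: "0 < s"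
    and W: "\<And>e f g. H e f g \<Longrightarrow> of_nat (16 * n\<^sup>2) * (W s e)\<^sup>2 \<le> \<bar>W s f * W s g\<bar>"
    by metis
  define T where "T k i j = W s (k, i, j)" for k i j
  define X where "X = (\<chi> k. if k \<in> K then puiseux_monom (s powr (y k - x k)) (x k) else 0)"
  let ?A = "pencil_entry Q X"
  have T: "T k i j = puiseux_monom (s powr (y k - x k)) (x k) * Q k $ i $ j" for k i j
    by (simp add: T_def W_def scaled_term_def)
  have monom_pos: "0 < puiseux_monom (s powr (y k - x k)) (x k)" for k
    using s by (simp add: puiseux_pos_iff lc_monom)
  have A: "?A i j = (\<Sum>k\<in>K. T k i j)" for i j
  proof -
    have "?A i j = (\<Sum>k\<in>UNIV. if k \<in> K then T k i j else 0)"
      unfolding pencil_entry_def T X_def by (intro sum.cong) auto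
    then show ?thesis by (simp add: sum.If_cases)
  qed
  have vanish: "?A i j = 0" if "\<forall>k\<in>K. Q k $ i $ j = 0" for i j
    using that by (simp add: A T)
  have dominant: "(\<forall>k\<in>K. Q k $ i $ j = 0) \<or> (\<exists>k. dominant_at Q K y i j k)" for i j
  proof -
    have "E y k i j \<noteq> E y l i j" if "k \<in> K" "l \<in> K" "k \<noteq> l" for k l
      using generic_y[of k k l i j i j i j] that by auto
    then show ?thesis using ex_dominant_at[of K Q i j y] unfolding E_def by blast
  qed
  have close: "2 * \<bar>?A i j - T k i j\<bar> \<le> \<bar>T k i j\<bar>" if k: "dominant_at Q K y i j k" for i j k
    unfolding A
  proof (rule dominant_term)
    show "k \<in> K" using k by (simp add: dominant_at_def)
    have "card K \<le> CARD('n)" by (rule card_mono) auto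
    then show "card K \<le> n" by (simp add: n_def)
    fix l assume l: "l \<in> K" "l \<noteq> k"
    show "(2 * of_nat n * T l i j)\<^sup>2 \<le> (T k i j)\<^sup>2"
    proof (cases "Q l $ i $ j = 0")
      case True
      then show ?thesis by (simp add: T)
    next
      case False
      then have "H (l, i, j) (k, i, j) (k, i, j)"
        using k l by (auto simp: H_def dominant_at_def E_def)
      then have "of_nat (16 * n\<^sup>2) * (T l i j)\<^sup>2 \<le> (T k i j)\<^sup>2"
        unfolding T_def using W by (metis abs_mult_self_eq abs_mult power2_eq_square)
      moreover have "(2 * of_nat n * T l i j)\<^sup>2 \<le> of_nat (16 * n\<^sup>2) * (T l i j)\<^sup>2"
        by (simp add: power_mult_distrib mult_right_mono)
      ultimately show ?thesis by (rule order_trans[rotated])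
    qed
  qed simp
  have pos: "T k i j \<le> 2 * ?A i j \<and> 0 < T k i j" if "dominant_at Q K y i j k" "0 < Q k $ i $ j" for i j k
  proof -
    have "0 < T k i j" unfolding T using monom_pos that(2) by simp
    then show ?thesis using close[OF that(1)] by (simp add: abs_if split: if_splits)
  qed
  have neg: "?A i j \<le> 0" if "dominant_at Q K y i j k" "Q k $ i $ j < 0" for i j k
  proof -
    have "T k i j < 0" unfolding T using monom_pos that(2) by (simp add: mult_pos_neg)
    then show ?thesis using close[OF that(1)] by (simp add: abs_if split: if_splits)
  qed
  have bounded: "\<bar>?A i j\<bar> \<le> 2 * \<bar>T k i j\<bar>" if "dominant_at Q K y i j k" for i j k
    using close[OF that] by (auto simp: abs_if split: if_splits)
  let ?y = "extend_point K y"
  have sign_at: "(0 < Q k $ i $ j \<longrightarrow> Qplus q i j ?y = ereal (E y k i j) \<and> Qminus q i j ?y < ereal (E y k i j)) \<and>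
      (Q k $ i $ j < 0 \<longrightarrow> Qminus q i j ?y = ereal (E y k i j) \<and> Qplus q i j ?y < ereal (E y k i j))"
    if "dominant_at Q K y i j k" for i j k
    using tropical_values_at_dominant[OF that] unfolding q_def E_def by blast
  have nonzero: "Q k $ i $ j \<noteq> 0" if "dominant_at Q K y i j k" for i j k
    using that by (simp add: dominant_at_def)
  have ge: "0 \<le> ?A i j" if "Qminus q i j ?y \<le> Qplus q i j ?y" for i j
  proof (cases "\<forall>k\<in>K. Q k $ i $ j = 0")
    case False
    then obtain k where k: "dominant_at Q K y i j k" using dominant by blast
    then have "0 < Q k $ i $ j" using sign_at[OF k] nonzero[OF k] that by (metis leD linorder_cases)
    then show ?thesis using pos[OF k] by simp
  qed (simp add: vanish)
  have le: "?A i j \<le> 0" if "Qplus q i j ?y \<le> Qminus q i j ?y" for i j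
  proof (cases "\<forall>k\<in>K. Q k $ i $ j = 0")
    case False
    then obtain k where k: "dominant_at Q K y i j k" using dominant by blast
    then have "Q k $ i $ j < 0" using sign_at[OF k] nonzero[OF k] that by (metis leD linorder_cases)
    then show ?thesis using neg[OF k] by simp
  qed (simp add: vanish)
  have piece_diag: "Qminus q i i ?y \<le> Qplus q i i ?y" for i using y by (simp add: trop_piece_def)
  have diag: "0 \<le> ?A i i" for i using ge piece_diag by blast
  have diag_dominant: "\<exists>k. dominant_at Q K y i i k \<and> 0 < Q k $ i $ i \<and> Qplus q i i ?y = ereal (E y k i i)"
    if "Qplus q i i ?y \<noteq> -\<infinity>" for i
  proof -
    have "\<exists>k. dominant_at Q K y i i k"
      using that dominant[of i i] Qplus_extend_point_vanishing[of K Q i i y] unfolding q_def by blast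
    then obtain k where k: "dominant_at Q K y i i k" by blast
    then have "0 < Q k $ i $ i"
      using sign_at[OF k] nonzero[OF k] piece_diag[of i] by (metis leD linorder_cases)
    then show ?thesis using k sign_at[OF k] by blast
  qed
  have minor: "(of_nat CARD('m) * ?A i j)\<^sup>2 \<le> ?A i i * ?A j j" if ij: "(i, j) \<in> \<Sigma>" for i j
  proof (cases "\<forall>k\<in>K. Q k $ i $ j = 0")
    case True
    then show ?thesis using diag by (simp add: vanish)
  next
    case False
    have "i \<noteq> j" using ij \<Sigma> by (auto simp: upper_pairs_def)
    obtain p where p: "dominant_at Q K y i j p" using False dominant by blast
    have "max (Qplus q i j ?y) (Qminus q i j ?y) = ereal (E y p i j)"
      using sign_at[OF p] nonzero[OF p] by (cases "0 < Q p $ i $ j") (auto simp: max_def)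
    moreover have "2 * max (Qplus q i j ?y) (Qminus q i j ?y) \<le> Qplus q i i ?y + Qplus q j j ?y"
      using y ij by (auto simp: trop_piece_def)
    ultimately have le_y: "ereal (2 * E y p i j) \<le> Qplus q i i ?y + Qplus q j j ?y"
      by (simp flip: times_ereal.simps(1))
    have "Qplus q t t ?y \<noteq> \<infinity>" for t using diag_dominant[of t] by force
    then have "Qplus q i i ?y \<noteq> \<infinity>" "Qplus q j j ?y \<noteq> \<infinity>" by blast+
    then have Qi: "Qplus q i i ?y \<noteq> -\<infinity>" and Qj: "Qplus q j j ?y \<noteq> -\<infinity>"
      using le_y by (cases "Qplus q i i ?y"; cases "Qplus q j j ?y"; simp)+
    obtain k where k: "dominant_at Q K y i i k" "0 < Q k $ i $ i" "Qplus q i i ?y = ereal (E y k i i)"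
      using diag_dominant[OF Qi] by blast
    obtain l where l: "dominant_at Q K y j j l" "0 < Q l $ j $ j" "Qplus q j j ?y = ereal (E y l j j)"
      using diag_dominant[OF Qj] by blast
    have K: "k \<in> K" "l \<in> K" "p \<in> K" using k l p by (auto simp: dominant_at_def)
    have "2 * E y p i j \<noteq> E y k i i + E y l j j"
    proof (cases "k = l \<and> l = p")
      case True
      then have "lead_exp (Q p $ i $ i) + lead_exp (Q p $ j $ j) \<noteq> 2 * lead_exp (Q p $ i $ j)"
        using generic_Q \<open>i \<noteq> j\<close> k(2) l(2) nonzero[OF p] unfolding no_diagonal_tie_def by blast
      then show ?thesis using True by (simp add: E_def)
    next
      case False
      then show ?thesis using generic_y[OF K False, of i i j j i j] by simp
    qed
    then have "2 * E y p i j < E y k i i + E y l j j" using le_y k(3) l(3) by simp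
    then have "H (p, i, j) (k, i, i) (l, j, j)"
      using K k(2) l(2) nonzero[OF p] by (auto simp: H_def)
    then have "of_nat (16 * n\<^sup>2) * (T p i j)\<^sup>2 \<le> T k i i * T l j j"
      using W[of "(p, i, j)" "(k, i, i)" "(l, j, j)"] pos[OF k(1,2)] pos[OF l(1,2)]
      by (simp add: T_def)
    also have "\<dots> \<le> (2 * ?A i i) * (2 * ?A j j)"
      using pos[OF k(1,2)] pos[OF l(1,2)] by (intro mult_mono) auto
    finally have upper: "4 * (of_nat (n\<^sup>2) * (T p i j)\<^sup>2) \<le> ?A i i * ?A j j" by simp
    have "(of_nat CARD('m) * ?A i j)\<^sup>2 \<le> (of_nat n * ?A i j)\<^sup>2"
      by (simp add: power_mult_distrib n_def mult_right_mono power_mono)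
    also have "\<dots> = of_nat (n\<^sup>2) * \<bar>?A i j\<bar>\<^sup>2" by (simp add: power_mult_distrib)
    also have "\<dots> \<le> of_nat (n\<^sup>2) * (2 * \<bar>T p i j\<bar>)\<^sup>2"
      using bounded[OF p] by (intro mult_left_mono power_mono) auto
    also have "\<dots> = 4 * (of_nat (n\<^sup>2) * (T p i j)\<^sup>2)" by (simp add: power_mult_distrib)
    finally show ?thesis using upper by (rule order_trans)
  qed
  have "0 \<le> X $ k \<and> val (X $ k) = extend_point K x $ k" for k
    using monom_pos[of k] s
    by (auto simp: X_def extend_point_def val_def lead_exp_monom)
  moreover have "R (i, j) (Qplus q i j ?y) (Qminus q i j ?y)" if "(i, j) \<in> upper_pairs - \<Sigma>" for i j
    using y that by (auto simp: trop_piece_def)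
  then have "(R (i, j) = (\<ge>) \<longrightarrow> 0 \<le> ?A i j) \<and> (R (i, j) = (\<le>) \<longrightarrow> ?A i j \<le> 0)"
    if "(i, j) \<in> upper_pairs - \<Sigma>" for i j
    using ge[of i j] le[of i j] that by metis
  ultimately show ?thesis using diag minor unfolding signed_lift_def by (intro exI[of _ X]) auto
qed


section \<open>Lifting the tropical spectrahedron\<close>

lemma extend_point_trop_support:
  assumes "x \<in> trop_points"
  shows "extend_point (trop_support x) (\<lambda>k\<in>trop_support x. real_of_ereal (x $ k)) = x"
proof -
  have "x $ k \<noteq> \<infinity>" for k using assms by (simp add: trop_points_def)
  then show ?thesis
    by (auto simp: extend_point_def trop_support_def vec_eq_iff ereal_real)
qed

lemma extend_point_stratum:
  assumes "y \<in> stratum K S" "S \<subseteq> trop_points"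
  shows "extend_point K y \<in> S"
proof -
  obtain x where x: "x \<in> S" "trop_support x = K" "y = (\<lambda>k\<in>K. real_of_ereal (x $ k))"
    using assms(1) by (auto simp: stratum_def)
  then have "extend_point K y = x" using extend_point_trop_support[of x] assms(2) by auto
  then show ?thesis using x(1) by simp
qed

lemma lift_of_regular_piece:
  fixes Q :: "'n::finite \<Rightarrow> puiseux ^ 'm::{finite,linorder} ^ 'm::{finite,linorder}"
  defines "q \<equiv> \<lambda>k. sval_matrix (Q k)"
  assumes generic_Q: "no_diagonal_tie Q"
    and x: "x \<in> trop_piece \<Sigma> R q" and \<Sigma>: "\<Sigma> \<subseteq> upper_pairs"
    and reg: "regular_in (powertop_real (trop_support x)) (stratum (trop_support x) (trop_piece \<Sigma> R q))"
  shows "\<exists>X. signed_lift Q \<Sigma> R x X"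
proof -
  define K where "K = trop_support x"
  define x' where "x' = (\<lambda>k\<in>K. real_of_ereal (x $ k))"
  have points: "trop_piece \<Sigma> R q \<subseteq> trop_points" by (auto simp: trop_piece_def)
  then have ext: "extend_point K x' = x"
    using extend_point_trop_support[of x] x by (auto simp: K_def x'_def)
  have x': "x' \<in> stratum K (trop_piece \<Sigma> R q)"
    using x by (auto simp: stratum_def x'_def K_def)
  define c where "c p r t k i j l i' j' =
      2 * lead_exp (Q p $ r $ t) - lead_exp (Q k $ i $ j) - lead_exp (Q l $ i' $ j')"
    for p r t k i j l i' j'
  define C where "C = (\<lambda>((p, r, t), (k, i, j), (l, i', j')). c p r t k i j l i' j') ` UNIV"
  have C: "finite C" "c p r t k i j l i' j' \<in> C" for p r t k i j l i' j'
  proof -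
    show "finite C" unfolding C_def by (rule finite_imageI) (rule finite)
    show "c p r t k i j l i' j' \<in> C"
      unfolding C_def by (rule image_eqI[of _ _ "((p, r, t), (k, i, j), (l, i', j'))"]) simp_all
  qed
  obtain y where y: "y \<in> stratum K (trop_piece \<Sigma> R q)"
    and gen: "\<And>k l p c. \<lbrakk>k \<in> K; l \<in> K; p \<in> K; c \<in> C; \<not> (k = l \<and> l = p)\<rbrakk> \<Longrightarrow> y k + y l - 2 * y p \<noteq> c"
    and near: "\<And>k l p c. \<lbrakk>k \<in> K; l \<in> K; p \<in> K; c \<in> C; x' k + x' l - 2 * x' p < c\<rbrakk> \<Longrightarrow>
      y k + y l - 2 * y p < c"
    using generic_point_near[OF reg[folded K_def] x' C(1)] by blast
  show ?thesis
    unfolding ext[symmetric]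
  proof (rule lift_generic_point[where y = y])
    show "extend_point K y \<in> trop_piece \<Sigma> R (\<lambda>k. sval_matrix (Q k))"
      using extend_point_stratum[OF y points] by (simp add: q_def)
    show "lead_exp (Q k $ i $ j) + y k + (lead_exp (Q l $ i' $ j') + y l)
        \<noteq> 2 * (lead_exp (Q p $ r $ t) + y p)"
      if "k \<in> K" "l \<in> K" "p \<in> K" "\<not> (k = l \<and> l = p)" for k l p i j i' j' r t
      using gen[OF that(1-3) C(2)[of p r t k i j l i' j'] that(4)] by (simp add: c_def)
    show "2 * (lead_exp (Q p $ r $ t) + x' p)
        \<le> lead_exp (Q k $ i $ j) + x' k + (lead_exp (Q l $ i' $ j') + x' l)"
      if "k \<in> K" "l \<in> K" "p \<in> K"
        and "2 * (lead_exp (Q p $ r $ t) + y p)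
          < lead_exp (Q k $ i $ j) + y k + (lead_exp (Q l $ i' $ j') + y l)" for k l p i j i' j' r t
      using near[OF that(1-3) C(2)[of p r t k i j l i' j']] that(4) by (fastforce simp: c_def)
  qed (fact generic_Q \<Sigma>)+
qed

text \<open>
  Every sign pattern on the complement \<open>F\<close> of \<open>\<Sigma>\<close> corresponds to a piece containing \<open>x\<close>, since the two
  sides of its constraints on \<open>F\<close> are equal at \<open>x\<close>. The lifts for all patterns are combined into one with
  vanishing entries on \<open>F\<close>.
\<close>

lemma trop_spectrahedron_subset:
  fixes Q :: "'n::finite \<Rightarrow> puiseux ^ 'm::{finite,linorder} ^ 'm::{finite,linorder}"
  defines "q \<equiv> \<lambda>k. sval_matrix (Q k)"
  assumes sym: "\<And>k. transpose (Q k) = Q k"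
    and generic: "no_diagonal_tie Q"
    and regular: "\<And>\<Sigma> R K. \<lbrakk>\<Sigma> \<subseteq> upper_pairs; R \<in> (upper_pairs - \<Sigma>) \<rightarrow>\<^sub>E {(\<le>), (\<ge>)}; K \<noteq> {}\<rbrakk> \<Longrightarrow>
      regular_in (powertop_real K) (stratum K (trop_piece \<Sigma> R q))"
    and x: "x \<in> trop_spectrahedron q"
  shows "\<exists>X\<in>spectrahedron Q. \<forall>k. val (X $ k) = x $ k"
proof (cases "trop_support x = {}")
  case True
  \<comment> \<open>The point all of whose coordinates are \<open>-\<infinity>\<close> lies on no stratum; its lift is \<open>0\<close>.\<close>
  have "psd (0 :: puiseux ^ 'm::{finite,linorder} ^ 'm::{finite,linorder})" by (simp add: psd_def vec_eq_iff transpose_def)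
  then have "0 \<in> spectrahedron Q" by (simp add: spectrahedron_def zero_vec_def)
  moreover have "\<forall>k. val ((0 :: puiseux ^ 'n) $ k) = x $ k"
    using True by (auto simp: trop_support_def val_def)
  ultimately show ?thesis by blast
next
  case nonempty: False
  define \<Sigma> where "\<Sigma> = {(i, j). i < j \<and>
      2 * max (Qplus q i j x) (Qminus q i j x) \<le> Qplus q i i x + Qplus q j j x}"
  define F where "F = upper_pairs - \<Sigma>"
  have \<Sigma>: "\<Sigma> \<subseteq> upper_pairs" by (auto simp: \<Sigma>_def upper_pairs_def)
  define minor where "minor = (\<lambda>(i, j). {X. 0 \<le> pencil_entry Q X i i \<and> 0 \<le> pencil_entry Q X j j \<and>
      (of_nat CARD('m) * pencil_entry Q X i j)\<^sup>2 \<le> pencil_entry Q X i i * pencil_entry Q X j j})"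
  define C where "C = (\<Inter>k. {X. 0 \<le> X $ k \<and> val (X $ k) = x $ k})
      \<inter> (\<Inter>i. {X. 0 \<le> pencil_entry Q X i i}) \<inter> (\<Inter>p\<in>\<Sigma>. minor p)"
  have "field_convex (minor p)" for p
    unfolding minor_def by (cases p) (simp add: field_convex_minor)
  then have convex: "field_convex C"
    unfolding C_def by (intro field_convex_Int field_convex_INT field_convex_val field_convex_diagonal)
  have "\<exists>X\<in>C. \<forall>p\<in>F. (case p of (i, j) \<Rightarrow> pencil_entry Q X i j) = 0"
  proof (rule common_zero_of_sign_patterns[OF _ convex])
    show "finite F" by simp
    show "(case p of (i, j) \<Rightarrow> pencil_entry Q (a *s X + b *s Y) i j)
        = a * (case p of (i, j) \<Rightarrow> pencil_entry Q X i j) + b * (case p of (i, j) \<Rightarrow> pencil_entry Q Y i j)"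
      for p a b X Y by (cases p) (simp add: pencil_entry_linear)
    fix D assume D: "D \<subseteq> F"
    define R :: "'m \<times> 'm \<Rightarrow> ereal \<Rightarrow> ereal \<Rightarrow> bool"
      where "R = (\<lambda>p\<in>F. if p \<in> D then (\<ge>) else (\<le>))"
    have "R \<in> F \<rightarrow>\<^sub>E {(\<le>), (\<ge>)}" by (auto simp: R_def)
    then have reg: "regular_in (powertop_real (trop_support x)) (stratum (trop_support x) (trop_piece \<Sigma> R q))"
      using regular[OF \<Sigma> _ nonempty] by (simp add: F_def)
    have "R (i, j) (Qplus q i j x) (Qminus q i j x)" if "(i, j) \<in> F" for i j
    proof -
      have "Qplus q i j x = Qminus q i j x"
        using x that by (auto simp: trop_spectrahedron_def F_def \<Sigma>_def upper_pairs_def)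
      then show ?thesis using that by (simp add: R_def)
    qed
    then have piece: "x \<in> trop_piece \<Sigma> R q"
      using x by (auto simp: trop_spectrahedron_def trop_piece_def F_def \<Sigma>_def)
    obtain X where "signed_lift Q \<Sigma> R x X"
      using lift_of_regular_piece[OF generic piece[unfolded q_def] \<Sigma> reg[unfolded q_def]] ..
    then have X: "\<forall>k. 0 \<le> X $ k \<and> val (X $ k) = x $ k" "\<forall>i. 0 \<le> pencil_entry Q X i i"
      "\<forall>(i, j)\<in>\<Sigma>. (of_nat CARD('m) * pencil_entry Q X i j)\<^sup>2 \<le> pencil_entry Q X i i * pencil_entry Q X j j"
      "\<forall>(i, j)\<in>F. (R (i, j) = (\<ge>) \<longrightarrow> 0 \<le> pencil_entry Q X i j) \<and>
         (R (i, j) = (\<le>) \<longrightarrow> pencil_entry Q X i j \<le> 0)"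
      unfolding signed_lift_def F_def by - (elim conjE, assumption)+
    have "X \<in> C" using X(1-3) by (auto simp: C_def minor_def)
    moreover have "0 \<le> pencil_entry Q X i j" if "(i, j) \<in> D" for i j
    proof -
      have "(i, j) \<in> F" "R (i, j) = (\<ge>)" using that D by (auto simp: R_def)
      then show ?thesis using X(4) by blast
    qed
    moreover have "pencil_entry Q X i j \<le> 0" if "(i, j) \<in> F - D" for i j
    proof -
      have "(i, j) \<in> F" "R (i, j) = (\<le>)" using that by (auto simp: R_def)
      then show ?thesis using X(4) by blast
    qed
    ultimately show "\<exists>X\<in>C. (\<forall>p\<in>D. 0 \<le> (case p of (i, j) \<Rightarrow> pencil_entry Q X i j)) \<and>
        (\<forall>p\<in>F - D. (case p of (i, j) \<Rightarrow> pencil_entry Q X i j) \<le> 0)"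
      by (intro bexI[of _ X]) auto
  qed
  then obtain X where "X \<in> C" and zero: "\<And>i j. (i, j) \<in> F \<Longrightarrow> pencil_entry Q X i j = 0" by fast
  then have X: "\<And>k. 0 \<le> X $ k" "\<And>k. val (X $ k) = x $ k" "\<And>i. 0 \<le> pencil_entry Q X i i"
    and minors: "\<And>i j. (i, j) \<in> \<Sigma> \<Longrightarrow>
      (of_nat CARD('m) * pencil_entry Q X i j)\<^sup>2 \<le> pencil_entry Q X i i * pencil_entry Q X j j"
    by (auto simp: C_def minor_def)
  have "Q k $ i $ j = Q k $ j $ i" for k i j
    using sym[of k] by (metis (mono_tags, lifting) transpose_def vec_lambda_beta)
  then have symA: "pencil_entry Q X i j = pencil_entry Q X j i" for i j
    by (simp add: pencil_entry_def)
  have upper: "(of_nat CARD('m) * pencil_entry Q X i j)\<^sup>2 \<le> pencil_entry Q X i i * pencil_entry Q X j j"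
    if "i < j" for i j
  proof (cases "(i, j) \<in> \<Sigma>")
    case False
    then have "(i, j) \<in> F" using that by (simp add: F_def upper_pairs_def)
    then show ?thesis using X(3) by (simp add: zero)
  qed (rule minors)
  have "psd (\<chi> i j. pencil_entry Q X i j)"
  proof (rule psd_if_strong_minors)
    show "transpose (\<chi> i j. pencil_entry Q X i j) = (\<chi> i j. pencil_entry Q X i j)"
      by (simp add: transpose_def vec_eq_iff symA)
    fix i j :: 'm assume "i \<noteq> j"
    then consider "i < j" | "j < i" by (rule linorder_neqE)
    then show "(of_nat CARD('m) * (\<chi> i j. pencil_entry Q X i j) $ i $ j)\<^sup>2
        \<le> (\<chi> i j. pencil_entry Q X i j) $ i $ i * (\<chi> i j. pencil_entry Q X i j) $ j $ j"
    proof cases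
      case 1
      then show ?thesis using upper[of i j] by simp
    next
      case 2
      then show ?thesis using upper[of j i] by (simp add: symA[of i j] mult.commute)
    qed
  qed (simp add: X)
  then have "X \<in> spectrahedron Q" using X(1) by (simp add: spectrahedron_def pencil_entry_def)
  then show ?thesis using X(2) by blast
qed

theorem theorem5p17:
  fixes Q :: "'n::finite \<Rightarrow> puiseux ^ 'm::{finite,linorder} ^ 'm::{finite,linorder}"
    and q :: "'n \<Rightarrow> signed_trop ^ 'm::{finite,linorder} ^ 'm::{finite,linorder}"
  assumes sym: "\<And>k. transpose (Q k) = Q k"
    and q_def: "\<And>k. q k = sval_matrix (Q k)"
    and generic: "\<And>k i j. i \<noteq> j \<Longrightarrow> q k $ i $ i \<in> range TPos \<Longrightarrow> q k $ j $ j \<in> range TPos \<Longrightarrow>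
      modulus (q k $ i $ i) + modulus (q k $ j $ j) \<noteq> 2 * modulus (q k $ i $ j)"
    and regular: "\<And>\<Sigma> R K. \<Sigma> \<subseteq> upper_pairs \<Longrightarrow> R \<in> (upper_pairs - \<Sigma>) \<rightarrow>\<^sub>E {(\<le>), (\<ge>)} \<Longrightarrow> K \<noteq> {} \<Longrightarrow>
      regular_in (powertop_real K) (stratum K (trop_piece \<Sigma> R q))"
  shows "(\<lambda>x. \<chi> k. val (x $ k)) ` spectrahedron Q = trop_spectrahedron q"
proof
  have q: "q = (\<lambda>k. sval_matrix (Q k))" using q_def by auto
  show "(\<lambda>x. \<chi> k. val (x $ k)) ` spectrahedron Q \<subseteq> trop_spectrahedron q"
    unfolding q using val_spectrahedron_subset by blast
  show "trop_spectrahedron q \<subseteq> (\<lambda>x. \<chi> k. val (x $ k)) ` spectrahedron Q"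
  proof
    fix x assume x: "x \<in> trop_spectrahedron q"
    have "no_diagonal_tie Q"
      unfolding no_diagonal_tie_def
    proof (intro allI impI)
      fix k i j assume "i \<noteq> j" "0 < Q k $ i $ i" "0 < Q k $ j $ j" "Q k $ i $ j \<noteq> 0"
      then show "lead_exp (Q k $ i $ i) + lead_exp (Q k $ j $ j) \<noteq> 2 * lead_exp (Q k $ i $ j)"
        using generic[of i j k] by (simp add: q sval_matrix_def modulus_sval val_def)
    qed
    then obtain X where X: "X \<in> spectrahedron Q" "\<forall>k. val (X $ k) = x $ k"
      using trop_spectrahedron_subset[OF sym _ regular[unfolded q] x[unfolded q]] by auto
    then have "x = (\<chi> k. val (X $ k))" by (simp add: vec_eq_iff)
    then show "x \<in> (\<lambda>x. \<chi> k. val (x $ k)) ` spectrahedron Q" using X(1) by blast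
  qed
qed


end
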